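(* Let $p$ be a prime and $k$ a positive integer. The number of $3\times 3$ matrices with entries in $\mathbb{Z}_{p^k}$ that are diagonalizable over $\mathbb{Z}_{p^k}$ is $$|\mathrm{Diag}_3(\mathbb{Z}_{p^k})| = p^k + \frac{p^{k+2}(p^3-1)(p^{5k}-1)}{p^5 - 1} + \frac{p^{k+3}(p^3-1)(p-2)(p+1)(p^{8k}-1)}{6(p^8 - 1)} + \frac{p^{k+3}(p^2-1)}{2}\left( \frac{p^{8k}-p^8}{p^8-1} - \frac{p^{5k}-p^5}{p^5-1}\right).$$
   Context: $\mathbb{Z}_{p^k}$ denotes the ring of integers modulo $p^k$. A matrix $A\in M_n(\mathbb{Z}_{p^k})$ is diagonalizable over $\mathbb{Z}_{p^k}$ if $A = PDP^{-1}$ for some invertible $P\in GL_n(\mathbb{Z}_{p^k})$ and some diagonal $D\in M_n(\mathbb{Z}_{p^k})$. $\mathrm{Diag}_n(\mathbb{Z}_{p^k})$ denotes the set of all $n\times n$ matrices over $\mathbb{Z}_{p^k}$ that are diagonalizable over $\mathbb{Z}_{p^k}$. *)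

theory Defs
  imports
    "Jordan_Normal_Form.Matrix"
    "Berlekamp_Zassenhaus.Finite_Field"
begin

(* similar_mat A D says A = P * D * Q for square P, Q with P * Q = 1 = Q * P,
   that is, A = P D P^(-1) with P in GL_n over the entry ring itself. *)
definition diagonalizable_mat :: "'a :: comm_ring_1 mat \<Rightarrow> bool" where
  "diagonalizable_mat A \<longleftrightarrow> (\<exists>D. diagonal_mat D \<and> similar_mat A D)"

definition Diag :: "nat \<Rightarrow> 'a :: comm_ring_1 mat set" where
  "Diag n = {A \<in> carrier_mat n n. diagonalizable_mat A}"

end

theory Submission
  imports Defs "HOL-Combinatorics.Multiset_Permutations" "Jordan_Normal_Form.Determinant"
begin

text \<open>
  Over a local ring two diagonal matrices are similar iff their diagonals agree as multisets: an
  invertible intertwiner has, by the Leibniz formula, a permutation all of whose entries are units,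
  and this permutation matches the eigenvalues. Hence the diagonalizable matrices are a disjoint
  union of similarity classes indexed by multisets of eigenvalues, and each class has size
  \<open>|GL\<^sub>3| / |C(D)|\<close>. A matrix \<open>X\<close> commutes with \<open>D = diag(d\<^sub>1, d\<^sub>2, d\<^sub>3)\<close> iff \<open>X\<^sub>i\<^sub>j\<close> annihilates
  \<open>d\<^sub>i - d\<^sub>j\<close>; in \<open>\<int>/p\<^sup>k\<close> an element of valuation \<open>v < k\<close> has annihilator of size \<open>p\<^sup>v\<close>, inside the
  maximal ideal, so modulo \<open>p\<close> only the blocks of equal eigenvalues decide whether \<open>X\<close> is invertible.
  Among three pairwise distinct eigenvalues the two smallest valuations of the differences coincide,
  which leaves sums of geometric type over one or two valuations.
\<close>

section \<open>Matrices over finite commutative rings\<close>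

text \<open>Dividing the order of GL_3 by that of a centralizer leaves a constant times a negative
  power of \<open>p\<close>, whose exponent is read off from the valuations of eigenvalue
  differences. Since only differences matter, one eigenvalue is free, which yields the factor
  \<open>p ^ k\<close> in every summand. Weighted by the number of differences of each valuation
  \<open>v\<close>, the sums become geometric in \<open>a = k - 1 - v\<close>: the ratio is
  \<open>p ^ 5\<close> for a repeated eigenvalue and \<open>p ^ 8\<close> for three equal
  valuations, and one larger valuation gives mixed terms \<open>p ^ (5 * a) * p ^ (3 * b)\<close>
  with \<open>b < a\<close>. The inner sum over \<open>b\<close> has denominator
  \<open>p ^ 3 - 1\<close>, which cancels against a factor of the class size. Hence only
  \<open>p ^ 5 - 1\<close> and \<open>p ^ 8 - 1\<close> survive as denominators, and the last
  summand of the formula is a difference. The two locales isolate what the count uses of the ring: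
  the nonunits are the multiples of one element, and the ideals generated by its powers have known
  sizes.\<close>

lemma card_eq_sum_card_fibres:
  assumes "finite A" "finite B" "f ` A \<subseteq> B"
  shows "card A = (\<Sum>b\<in>B. card {a \<in> A. f a = b})"
  using sum.group[OF assms, of "\<lambda>_. 1 :: nat"] by simp

lemma bij_betw_mat_entries:
  "bij_betw (mat n m) (PiE ({..<n} \<times> {..<m}) (\<lambda>(i, j). S i j))
     {A \<in> carrier_mat n m. \<forall>i<n. \<forall>j<m. A $$ (i, j) \<in> S i j}"
proof (rule bij_betw_byWitness[where f' = "\<lambda>A. restrict (($$) A) ({..<n} \<times> {..<m})"])
  show "\<forall>f\<in>PiE ({..<n} \<times> {..<m}) (\<lambda>(i, j). S i j). restrict (($$) (mat n m f)) ({..<n} \<times> {..<m}) = f"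
    by (auto simp: PiE_def extensional_def fun_eq_iff restrict_def)
qed (auto simp: PiE_def Pi_def extensional_def)

lemma card_mat_entries:
  "card {A \<in> carrier_mat n m. \<forall>i<n. \<forall>j<m. A $$ (i, j) \<in> S i j} = (\<Prod>i<n. \<Prod>j<m. card (S i j))"
  by (simp add: bij_betw_same_card[OF bij_betw_mat_entries, symmetric] card_PiE
      prod.cartesian_product case_prod_unfold)

lemma finite_carrier_mat [simp]: "finite (carrier_mat n m :: 'a :: finite mat set)"
proof -
  have "finite (PiE ({..<n} \<times> {..<m}) (\<lambda>(i, j). UNIV :: 'a set))"
    by (intro finite_PiE) auto
  then show ?thesis
    using bij_betw_finite[OF bij_betw_mat_entries[of n m "\<lambda>_ _. UNIV :: 'a set"]] by simp
qed

lemma bij_betw_four_block_mat: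
  "bij_betw (\<lambda>(A :: 'a mat, B, C, D). four_block_mat A B C D)
     (carrier_mat n1 m1 \<times> carrier_mat n1 m2 \<times> carrier_mat n2 m1 \<times> carrier_mat n2 m2)
     (carrier_mat (n1 + n2) (m1 + m2))"
proof (rule bij_betw_byWitness[where f' = "\<lambda>X. split_block X n1 m1"], goal_cases)
  case 1
  show ?case by (clarsimp simp: split_block_def, intro conjI eq_matI; auto)
next
  case 2
  show ?case
  proof
    fix X :: "'a mat" assume X: "X \<in> carrier_mat (n1 + n2) (m1 + m2)"
    obtain A B C D where "split_block X n1 m1 = (A, B, C, D)" by (cases "split_block X n1 m1")
    with split_block(5)[OF this, of n2 m2] X
    show "(case split_block X n1 m1 of (A, B, C, D) \<Rightarrow> four_block_mat A B C D) = X" by simp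
  qed
next
  case 4
  show ?case by (auto simp: split_block_def Let_def)
qed auto

section \<open>Congruence of determinants modulo a ring element\<close>

lemma dvd_prod_diff:
  fixes f g :: "'b \<Rightarrow> 'a :: comm_ring_1"
  assumes "\<And>i. i \<in> I \<Longrightarrow> d dvd f i - g i"
  shows "d dvd prod f I - prod g I"
  using assms
proof (induction I rule: infinite_finite_induct)
  case (insert x F)
  have "f x * prod f F - g x * prod g F = (f x - g x) * prod f F + g x * (prod f F - prod g F)"
    by (simp add: algebra_simps)
  then show ?case using insert by (simp add: dvd_add dvd_mult dvd_mult2)
qed auto

text \<open>Lets entries from the maximal ideal be replaced by 0 when a determinant is tested for
  being a unit. Congruence is phrased by divisibility, so no quotient ring or reduced matrix has to
  be formed.\<close>

lemma dvd_det_diff: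
  fixes A B :: "'a :: comm_ring_1 mat"
  assumes "A \<in> carrier_mat n n" "B \<in> carrier_mat n n"
    and "\<And>i j. i < n \<Longrightarrow> j < n \<Longrightarrow> d dvd A $$ (i, j) - B $$ (i, j)"
  shows "d dvd det A - det B"
proof -
  have "det A - det B = (\<Sum>p | p permutes {0..<n}.
      signof p * ((\<Prod>i = 0..<n. A $$ (i, p i)) - (\<Prod>i = 0..<n. B $$ (i, p i))))"
    by (simp add: det_def'[OF assms(1)] det_def'[OF assms(2)] sum_subtractf right_diff_distrib)
  also have "d dvd \<dots>"
    by (rule dvd_sum, rule dvd_mult, rule dvd_prod_diff) (auto intro!: assms(3) dest: permutes_in_image)
  finally show ?thesis .
qed

section \<open>Invertible matrices, similarity and the orbit-stabilizer count\<close>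

definition GL :: "nat \<Rightarrow> 'a :: comm_ring_1 mat set" where
  "GL n = {P \<in> carrier_mat n n. det P dvd 1}"

lemma GL_carrier [simp]: "P \<in> GL n \<Longrightarrow> P \<in> carrier_mat n n"
  by (simp add: GL_def)

lemma GL_det: "P \<in> GL n \<Longrightarrow> det P dvd 1"
  by (simp add: GL_def del: GL_carrier)

lemma finite_GL [simp]: "finite (GL n :: 'a :: {finite, comm_ring_1} mat set)"
  by (rule finite_subset[OF _ finite_carrier_mat[of n n]]) auto

lemma GL_mult: "P \<in> GL n \<Longrightarrow> Q \<in> GL n \<Longrightarrow> P * Q \<in> GL n"
  using mult_dvd_mono[of "det P" 1 "det Q" 1] by (auto simp: GL_def det_mult[of P n Q] simp del: GL_carrier)

lemma GL_if_mult_one: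
  assumes "P \<in> carrier_mat n n" "Q \<in> carrier_mat n n" "P * Q = 1\<^sub>m n"
  shows "P \<in> GL n"
  using det_mult[OF assms(1,2)] assms(1) unfolding GL_def assms(3) det_one
  by (metis (lifting) dvd_triv_left mem_Collect_eq)

lemma smult_smult_mat: "a \<cdot>\<^sub>m (b \<cdot>\<^sub>m A) = (a * b :: 'a :: comm_ring_1) \<cdot>\<^sub>m A"
  by (rule eq_matI) (auto simp: mult.assoc)

text \<open>The inverse is the adjugate scaled by the inverse of the determinant, so over any
  commutative ring a unit determinant amounts to a two-sided inverse.\<close>

lemma GL_inverse:
  assumes P: "P \<in> GL n"
  obtains Q where "Q \<in> GL n" "P * Q = 1\<^sub>m n" "Q * P = 1\<^sub>m n"
proof -
  from P have carr: "P \<in> carrier_mat n n" by simp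
  from P obtain u where u: "det P * u = 1" by (metis (lifting) GL_def dvdE mem_Collect_eq)
  let ?Q = "u \<cdot>\<^sub>m adj_mat P"
  have eq: "P * ?Q = 1\<^sub>m n" "?Q * P = 1\<^sub>m n" "?Q \<in> carrier_mat n n"
    using adj_mat[OF carr] carr u
    by (auto simp: mult_smult_distrib[OF carr] mult_smult_assoc_mat[of _ n n _ n] smult_smult_mat
        mult.commute[of u])
  then show ?thesis using GL_if_mult_one[OF eq(3) carr] that by blast
qed

text \<open>Without the inverse, similarity becomes an equation linear in \<open>P\<close>, which
  for diagonal matrices splits into one condition per entry.\<close>

lemma similar_mat_iff_GL:
  assumes A: "A \<in> carrier_mat n n" and D: "D \<in> carrier_mat n n"
  shows "similar_mat A D \<longleftrightarrow> (\<exists>P\<in>GL n. A * P = P * D)"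
proof
  assume "similar_mat A D"
  then obtain P Q where PQ: "similar_mat_wit A D P Q" by (auto simp: similar_mat_def)
  note w = similar_mat_witD2[OF A PQ]
  have "A * P = P * D * (Q * P)"
    unfolding w(3) using w by (simp add: assoc_mult_mat[of _ n n _ n _ n])
  then show "\<exists>P\<in>GL n. A * P = P * D"
    using w GL_if_mult_one[of P n Q] by (intro bexI[of _ P]) auto
next
  assume "\<exists>P\<in>GL n. A * P = P * D"
  then obtain P where P: "P \<in> GL n" "A * P = P * D" by blast
  obtain Q where Q: "Q \<in> GL n" "P * Q = 1\<^sub>m n" "Q * P = 1\<^sub>m n" by (rule GL_inverse[OF P(1)])
  have "A = A * (P * Q)" using A Q by simp
  also have "\<dots> = A * P * Q" using A P Q by (subst assoc_mult_mat[of _ n n _ n _ n]) auto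
  also have "\<dots> = P * D * Q" using P by simp
  finally show "similar_mat A D"
    using A D P Q by (intro similar_matI[of _ _ P Q n]) auto
qed

lemma mult_left_cancel_GL:
  assumes "P \<in> GL n" "X \<in> carrier_mat n m" "Y \<in> carrier_mat n m" "P * X = P * Y"
  shows "X = Y"
proof -
  obtain Q where Q: "Q \<in> GL n" "P * Q = 1\<^sub>m n" "Q * P = 1\<^sub>m n" by (rule GL_inverse[OF assms(1)])
  note assoc = assoc_mult_mat[OF GL_carrier[OF Q(1)] GL_carrier[OF assms(1)]]
  have "X = Q * P * X" using Q(3) assms(2) by simp
  also have "\<dots> = Q * P * Y" unfolding assoc[OF assms(2)] assoc[OF assms(3)] assms(4) ..
  also have "\<dots> = Y" using Q(3) assms(3) by simp
  finally show ?thesis .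
qed

definition centralizer_GL :: "'a :: comm_ring_1 mat \<Rightarrow> 'a mat set" where
  "centralizer_GL D = {X \<in> GL (dim_row D). D * X = X * D}"

text \<open>The intertwiners form a coset of the centralizer: left multiplication by any one of them
  is a bijection from the centralizer onto all of them.\<close>

lemma card_intertwiners:
  assumes "A \<in> carrier_mat n n" "D \<in> carrier_mat n n" "similar_mat A D"
  shows "card {P \<in> GL n. A * P = P * D} = card (centralizer_GL D)"
proof -
  obtain P where P: "P \<in> GL n" "A * P = P * D"
    using assms similar_mat_iff_GL by blast
  obtain Q where Q: "Q \<in> GL n" "P * Q = 1\<^sub>m n" "Q * P = 1\<^sub>m n" by (rule GL_inverse[OF P(1)])
  note carr = assms(1,2) GL_carrier[OF P(1)] GL_carrier[OF Q(1)]
  note assoc = assoc_mult_mat[of _ n n _ n _ n]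
  have Q_P: "Q * (P * X) = X" and P_Q: "P * (Q * X) = X" if "X \<in> carrier_mat n n" for X
    using carr Q that by (simp_all flip: assoc)
  have "bij_betw (\<lambda>X. P * X) (centralizer_GL D) {P \<in> GL n. A * P = P * D}"
  proof (rule bij_betw_byWitness[where f' = "\<lambda>X. Q * X"])
    show "\<forall>X\<in>centralizer_GL D. Q * (P * X) = X"
      using carr Q_P by (auto simp: centralizer_GL_def)
    show "\<forall>X\<in>{P \<in> GL n. A * P = P * D}. P * (Q * X) = X"
      using carr P_Q by auto
    show "(\<lambda>X. P * X) ` centralizer_GL D \<subseteq> {P \<in> GL n. A * P = P * D}"
    proof clarify
      fix X assume "X \<in> centralizer_GL D"
      then have X: "X \<in> GL n" "D * X = X * D" using carr by (auto simp: centralizer_GL_def)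
      note X_carr = GL_carrier[OF X(1)]
      have "A * (P * X) = P * D * X"
        unfolding P(2)[symmetric] using carr X_carr by (intro assoc[symmetric])
      also have "\<dots> = P * X * D"
        using assoc[OF carr(3,2) X_carr] assoc[OF carr(3) X_carr carr(2)] X(2) by simp
      finally show "P * X \<in> GL n \<and> A * (P * X) = P * X * D"
        using P X by (simp add: GL_mult)
    qed
    show "(\<lambda>X. Q * X) ` {P \<in> GL n. A * P = P * D} \<subseteq> centralizer_GL D"
    proof clarify
      fix X assume X: "X \<in> GL n" "A * X = X * D"
      note X_carr = GL_carrier[OF X(1)]
      have "P * (D * (Q * X)) = A * (P * (Q * X))"
        using assoc[OF carr(3,2), of "Q * X"] assoc[OF carr(1,3), of "Q * X"] carr X_carr P(2) by simp
      also have "\<dots> = P * (Q * (X * D))" using P_Q[OF X_carr] P_Q[OF mult_carrier_mat[OF X_carr carr(2)]] X by simp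
      also have "\<dots> = P * (Q * X * D)" using carr X_carr by (simp add: assoc)
      finally have "D * (Q * X) = Q * X * D"
        using mult_left_cancel_GL[OF P(1), of "D * (Q * X)" n "Q * X * D"] carr X_carr by simp
      then show "Q * X \<in> centralizer_GL D"
        using carr X Q by (auto simp: centralizer_GL_def GL_mult)
    qed
  qed
  then show ?thesis by (rule bij_betw_same_card[symmetric])
qed

text \<open>Orbit-stabilizer, proved by summing over the fibres of the conjugation map from
  \<open>GL n\<close> onto the similarity class; every fibre is a set of intertwiners and so has the
  size of the centralizer.\<close>

lemma card_conjugacy_class:
  fixes D :: "'a :: {finite, comm_ring_1} mat"
  assumes D: "D \<in> carrier_mat n n"
  shows "card {A \<in> carrier_mat n n. similar_mat A D} * card (centralizer_GL D) = card (GL n :: 'a mat set)"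
proof -
  let ?cl = "{A \<in> carrier_mat n n. similar_mat A D}"
  \<comment> \<open>The witness is P D P^(-1). The function \<open>f\<close> chosen from this
    statement is therefore conjugation of \<open>D\<close>, but it is characterized by an equation
    free of inverses.\<close>
  have ex: "\<exists>A. A \<in> carrier_mat n n \<and> A * P = P * D" if P: "P \<in> GL n" for P
  proof -
    obtain Q where Q: "Q \<in> GL n" "P * Q = 1\<^sub>m n" "Q * P = 1\<^sub>m n" by (rule GL_inverse[OF P])
    have "P * D * Q * P = P * D"
      using D GL_carrier[OF P] GL_carrier[OF Q(1)] Q by (simp add: assoc_mult_mat[of _ n n _ n _ n])
    then show ?thesis
      using D GL_carrier[OF P] GL_carrier[OF Q(1)] by (intro exI[of _ "P * D * Q"]) auto
  qed
  then obtain f where f: "\<And>P. P \<in> GL n \<Longrightarrow> f P \<in> carrier_mat n n \<and> f P * P = P * D"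
    by metis
  have uniq: "f P = A" if P: "P \<in> GL n" and A: "A \<in> carrier_mat n n" "A * P = P * D" for A P
  proof -
    obtain Q where Q: "Q \<in> GL n" "P * Q = 1\<^sub>m n" "Q * P = 1\<^sub>m n" by (rule GL_inverse[OF P])
    note assoc = assoc_mult_mat[OF _ GL_carrier[OF P] GL_carrier[OF Q(1)], of _ n]
    have "f P * (P * Q) = A * (P * Q)" using f[OF P] A assoc[OF A(1)] assoc[of "f P"] by simp
    then show ?thesis using f[OF P] A(1) Q(2) by (simp add: right_mult_one_mat[of _ n n])
  qed
  have "card (GL n :: 'a mat set) = (\<Sum>A\<in>?cl. card {P \<in> GL n. f P = A})"
  proof (intro card_eq_sum_card_fibres)
    show "f ` GL n \<subseteq> ?cl" using f similar_mat_iff_GL[OF _ D] by blast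
  qed (auto intro: finite_subset[OF _ finite_carrier_mat[of n n]])
  also have "\<dots> = (\<Sum>A\<in>?cl. card {P \<in> GL n. A * P = P * D})"
    using f uniq by (intro sum.cong arg_cong[of _ _ card]) auto
  also have "\<dots> = (\<Sum>A\<in>?cl. card (centralizer_GL D))"
    using D by (intro sum.cong refl card_intertwiners) auto
  finally show ?thesis by simp
qed

section \<open>Invertible matrices with a prescribed first column\<close>

lemma four_block_mat_eq_iff:
  assumes "A \<in> carrier_mat n1 m1" "B \<in> carrier_mat n1 m2" "C \<in> carrier_mat n2 m1" "D \<in> carrier_mat n2 m2"
    and "A' \<in> carrier_mat n1 m1" "B' \<in> carrier_mat n1 m2" "C' \<in> carrier_mat n2 m1" "D' \<in> carrier_mat n2 m2"
  shows "four_block_mat A B C D = four_block_mat A' B' C' D' \<longleftrightarrow> A = A' \<and> B = B' \<and> C = C' \<and> D = D'"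
  using inj_onD[OF bij_betw_imp_inj_on[OF bij_betw_four_block_mat[of n1 m1 m2 n2]],
      of "(A, B, C, D)" "(A', B', C', D')"] assms by auto

lemma four_block_mat_cases:
  assumes "X \<in> carrier_mat (n1 + n2) (m1 + m2)"
  obtains A B C D where "A \<in> carrier_mat n1 m1" "B \<in> carrier_mat n1 m2" "C \<in> carrier_mat n2 m1"
    "D \<in> carrier_mat n2 m2" "X = four_block_mat A B C D"
proof -
  have "X \<in> (\<lambda>(A, B, C, D). four_block_mat A B C D) `
      (carrier_mat n1 m1 \<times> carrier_mat n1 m2 \<times> carrier_mat n2 m1 \<times> carrier_mat n2 m2)"
    using bij_betw_imp_surj_on[OF bij_betw_four_block_mat[of n1 m1 m2 n2]] assms by blast
  then show ?thesis using that by auto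
qed

text \<open>Swapping rows 0 and \<open>i\<close> brings the unit to the corner. Filled up with the
  identity, the swapped column gives a lower triangular \<open>L\<close> of determinant
  \<open>v i\<close>, and \<open>Q\<close> undoes the swap.\<close>

lemma GL_exists_first_col:
  fixes v :: "nat \<Rightarrow> 'a :: comm_ring_1"
  assumes i: "i < Suc n" and unit: "v i dvd 1"
  shows "\<exists>Q\<in>GL (Suc n). \<forall>r<Suc n. Q $$ (r, 0) = v r"
proof -
  define t where "t = Transposition.transpose 0 i"
  have t: "t permutes {0..<Suc n}" unfolding t_def using i by (intro permutes_swap_id) auto
  define L where "L = mat (Suc n) (Suc n) (\<lambda>(r, c). if c = 0 then v (t r) else if r = c then 1 else 0)"
  define Q where "Q = mat (Suc n) (Suc n) (\<lambda>(r, c). L $$ (t r, c))"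
  have L: "L \<in> carrier_mat (Suc n) (Suc n)" by (simp add: L_def)
  have "det L = prod_list (diag_mat L)"
    by (rule det_lower_triangular[OF _ L]) (auto simp: L_def)
  also have "diag_mat L = v i # map (\<lambda>_. 1) [0..<n]"
    by (simp add: diag_mat_def L_def t_def upt_conv_Cons map_Suc_upt[symmetric] del: upt_Suc)
  finally have "det L = v i" by (simp add: map_replicate_const)
  moreover have "det Q = signof t * det L"
    unfolding Q_def by (rule det_permute_rows[OF L t])
  ultimately have "det Q dvd 1"
    using unit by (simp add: sign_def split: if_splits)
  moreover have "Q $$ (r, 0) = v r" if "r < Suc n" for r
    using that permutes_in_image[OF t, of r] by (simp add: Q_def L_def) (simp add: t_def)
  ultimately show ?thesis by (intro bexI[of _ Q]) (auto simp: GL_def Q_def simp del: GL_carrier)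
qed

text \<open>These matrices are the coset \<open>Q * H\<close>, where \<open>H\<close> consists of
  the invertible matrices whose first column is the first unit vector. In block form
  \<open>H\<close> has a free row \<open>B\<close> and an arbitrary invertible block
  \<open>D\<close>.\<close>

lemma card_GL_first_col:
  fixes v :: "nat \<Rightarrow> 'a :: {finite, comm_ring_1}"
  assumes "\<exists>i<Suc n. v i dvd 1"
  shows "card {P \<in> GL (Suc n). \<forall>r<Suc n. P $$ (r, 0) = v r} = CARD('a) ^ n * card (GL n :: 'a mat set)"
proof -
  let ?S = "carrier_mat 1 n \<times> GL n :: ('a mat \<times> 'a mat) set"
  let ?F = "\<lambda>(B, D). four_block_mat (1\<^sub>m 1) B (0\<^sub>m n 1) D :: 'a mat"
  obtain Q where Q: "Q \<in> GL (Suc n)" "\<forall>r<Suc n. Q $$ (r, 0) = v r"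
    using assms GL_exists_first_col by blast
  obtain R where R: "R \<in> GL (Suc n)" "Q * R = 1\<^sub>m (Suc n)" "R * Q = 1\<^sub>m (Suc n)"
    by (rule GL_inverse[OF Q(1)])
  note carr = GL_carrier[OF Q(1)] GL_carrier[OF R(1)]
  have F_carrier: "?F (B, D) \<in> carrier_mat (Suc n) (Suc n)"
    if "B \<in> carrier_mat 1 n" "D \<in> carrier_mat n n" for B D :: "'a mat"
    using four_block_carrier_mat[of "1\<^sub>m 1 :: 'a mat" 1 1 D n n B "0\<^sub>m n 1"] that by simp
  have det_F: "det (?F (B, D)) = det D"
    if "B \<in> carrier_mat 1 n" "D \<in> carrier_mat n n" for B D
    using det_four_block_mat_lower_left_zero_col[of "1\<^sub>m 1" B n "0\<^sub>m n 1" D] that by simp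
  have "bij_betw (\<lambda>X. Q * ?F X) ?S
      {P \<in> GL (Suc n). \<forall>r<Suc n. P $$ (r, 0) = v r}"
  proof (rule bij_betwI')
    fix X Y assume XY: "X \<in> ?S" "Y \<in> ?S"
    then obtain B D B' D' where eq: "X = (B, D)" "Y = (B', D')"
      and carr': "B \<in> carrier_mat 1 n" "D \<in> carrier_mat n n" "B' \<in> carrier_mat 1 n" "D' \<in> carrier_mat n n"
      by (metis GL_carrier SigmaE)
    have "Q * ?F X = Q * ?F Y \<longleftrightarrow> ?F X = ?F Y"
      unfolding eq using mult_left_cancel_GL[OF Q(1) F_carrier[OF carr'(1,2)] F_carrier[OF carr'(3,4)]] by metis
    also have "\<dots> \<longleftrightarrow> X = Y"
      using four_block_mat_eq_iff[of "1\<^sub>m 1 :: 'a mat" 1 1 B n "0\<^sub>m n 1" n D "1\<^sub>m 1" B' "0\<^sub>m n 1" D'] carr'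
      by (simp add: eq)
    finally show "(Q * ?F X = Q * ?F Y) = (X = Y)" .
  next
    fix X assume X: "X \<in> ?S"
    obtain B D where BD: "X = (B, D)" by (cases X)
    have bd: "B \<in> carrier_mat 1 n" "D \<in> GL n" "D \<in> carrier_mat n n" using X BD by auto
    have FX: "?F X \<in> GL (Suc n)"
      using F_carrier[OF bd(1,3)] det_F[OF bd(1,3)] bd(2) BD by (simp add: GL_def del: GL_carrier)
    \<comment> \<open>The first column of a product depends only on the first column of its right
      factor, so multiplying \<open>Q\<close> by \<open>?F X\<close> or by the identity gives the
      same first column.\<close>
    have "col (?F X) 0 = col (1\<^sub>m (Suc n)) 0"
      using bd(1,3) by (intro eq_vecI) (auto simp: BD)
    then have "col (Q * ?F X) 0 = col Q 0"
      using col_mult2[OF carr(1) GL_carrier[OF FX], of 0] col_mult2[OF carr(1) one_carrier_mat, of 0] carr by simp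
    then have "(Q * ?F X) $$ (r, 0) = Q $$ (r, 0)" if "r < Suc n" for r
      using that carr GL_carrier[OF FX] index_col[of r "Q * ?F X" 0] index_col[of r Q 0] by simp
    then show "Q * ?F X \<in> {P \<in> GL (Suc n). \<forall>r<Suc n. P $$ (r, 0) = v r}"
      using GL_mult[OF Q(1) FX] Q(2) by simp
  next
    fix P assume P: "P \<in> {P \<in> GL (Suc n). \<forall>r<Suc n. P $$ (r, 0) = v r}"
    have P_carr: "P \<in> carrier_mat (Suc n) (Suc n)" and P_col: "\<forall>r<Suc n. P $$ (r, 0) = v r"
      using P by simp_all
    \<comment> \<open>\<open>P\<close> and \<open>Q\<close> share their first column and
      \<open>R\<close> inverts \<open>Q\<close>, so the first column of \<open>X\<close> is the
      first unit vector; this forces \<open>A\<close> and \<open>C\<close> below.\<close>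
    define X where "X = R * P"
    have X: "X \<in> GL (Suc n)" unfolding X_def using P R GL_mult by blast
    obtain A B C D where blocks: "A \<in> carrier_mat 1 1" "B \<in> carrier_mat 1 n" "C \<in> carrier_mat n 1"
      "D \<in> carrier_mat n n" "X = four_block_mat A B C D"
      by (rule four_block_mat_cases[of "X" 1 n 1 n]) (use GL_carrier[OF X] in simp_all)
    have "col P 0 = col Q 0"
      using P_carr P_col carr(1) Q(2) by (intro eq_vecI) auto
    then have "col (X) 0 = col (1\<^sub>m (Suc n)) 0"
      using col_mult2[OF carr(2) P_carr, of 0] col_mult2[OF carr(2,1), of 0] R(3) by (simp add: X_def)
    then have first_col: "(X) $$ (r, 0) = (if r = 0 then 1 else 0)" if "r < Suc n" for r
      using that GL_carrier[OF X] index_col[of r "X" 0] by simp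
    have "A = 1\<^sub>m 1"
      using first_col[of 0] blocks by (intro eq_matI) auto
    moreover have "C = 0\<^sub>m n 1"
    proof (intro eq_matI)
      fix i j assume "i < dim_row (0\<^sub>m n 1 :: 'a mat)" "j < dim_col (0\<^sub>m n 1 :: 'a mat)"
      then show "C $$ (i, j) = 0\<^sub>m n 1 $$ (i, j)"
        using first_col[of "Suc i"] blocks by auto
    qed (use blocks in auto)
    ultimately have eq: "X = ?F (B, D)" using blocks by simp
    then have "D \<in> GL n" using X det_F[OF blocks(2,4)] blocks(4) by (simp add: GL_def del: GL_carrier)
    moreover have "P = Q * (R * P)"
      using assoc_mult_mat[OF carr P_carr] R(2) P_carr by simp
    then have "P = Q * ?F (B, D)" unfolding eq[symmetric] X_def .
    ultimately show "\<exists>X\<in>?S. P = Q * ?F X"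
      using blocks by (intro bexI[of _ "(B, D)"]) auto
  qed
  then have "card {P \<in> GL (Suc n). \<forall>r<Suc n. P $$ (r, 0) = v r} = card ?S"
    by (rule bij_betw_same_card[symmetric])
  moreover have "card (carrier_mat 1 n :: 'a mat set) = CARD('a) ^ n"
    using card_mat_entries[of 1 n "\<lambda>_ _. UNIV :: 'a set"] by simp
  ultimately show ?thesis by (simp add: card_cartesian_product)
qed

section \<open>General linear groups over local rings with principal maximal ideal\<close>

text \<open>The assumption says that the nonunits are exactly the ideal generated by
  \<open>\<pi>\<close>, which is then the unique maximal ideal.\<close>

locale principal_local_ring =
  fixes \<pi> :: "'a :: {finite, comm_ring_1}"
  assumes unit_iff: "x dvd 1 \<longleftrightarrow> \<not> \<pi> dvd x"
begin

lemma pi_dvd_mult_iff: "\<pi> dvd x * y \<longleftrightarrow> \<pi> dvd x \<or> \<pi> dvd y"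
proof (cases "\<pi> dvd x \<or> \<pi> dvd y")
  case False
  then have "x * y dvd 1" using mult_dvd_mono[of x 1 y 1] by (simp add: unit_iff[of x] unit_iff[of y])
  then show ?thesis using False unit_iff by blast
qed auto

lemma pi_dvd_prod_iff: "finite I \<Longrightarrow> \<pi> dvd prod f I \<longleftrightarrow> (\<exists>i\<in>I. \<pi> dvd f i)"
  by (induction I rule: finite_induct) (use unit_iff[of 1] in \<open>simp_all add: pi_dvd_mult_iff\<close>)

lemma pi_dvd_cong: "\<pi> dvd x - y \<Longrightarrow> \<pi> dvd x \<longleftrightarrow> \<pi> dvd y"
  using dvd_add_right_iff[of \<pi> "x - y" y] by simp

lemma unit_det_imp_unit_entries:
  fixes P :: "'a mat"
  assumes "P \<in> carrier_mat n n" "det P dvd 1"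
  obtains \<sigma> where "\<sigma> permutes {0..<n}" "\<And>i. i < n \<Longrightarrow> P $$ (i, \<sigma> i) dvd 1"
proof -
  have "\<exists>\<sigma>. \<sigma> permutes {0..<n} \<and> \<not> \<pi> dvd signof \<sigma> * (\<Prod>i = 0..<n. P $$ (i, \<sigma> i))"
  proof (rule ccontr)
    assume "\<not> ?thesis"
    then have "\<pi> dvd det P" unfolding det_def'[OF assms(1)] by (intro dvd_sum) blast
    then show False using assms(2) unit_iff by blast
  qed
  then show ?thesis
    using that unfolding pi_dvd_mult_iff pi_dvd_prod_iff[OF finite_atLeastLessThan] unit_iff by fastforce
qed

abbreviation "nonunits \<equiv> {x. \<pi> dvd x}"

text \<open>A first column occurs in \<open>GL\<close> iff some entry of it is a unit, and all such
  columns occur equally often. The difference counts the columns that do not lie entirely in the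
  maximal ideal.\<close>

lemma card_GL_Suc:
  "card (GL (Suc n) :: 'a mat set)
    = (CARD('a) ^ Suc n - card nonunits ^ Suc n) * (CARD('a) ^ n * card (GL n :: 'a mat set))"
proof -
  let ?all = "PiE {..<Suc n} (\<lambda>_. UNIV :: 'a set)"
  let ?non = "PiE {..<Suc n} (\<lambda>_. nonunits)"
  let ?col = "\<lambda>P :: 'a mat. restrict (\<lambda>r. P $$ (r, 0)) {..<Suc n}"
  have fibre: "{P \<in> GL (Suc n). ?col P = v} = {P \<in> GL (Suc n). \<forall>r<Suc n. P $$ (r, 0) = v r}"
    if "v \<in> ?all" for v
    using that by (auto simp: fun_eq_iff restrict_def PiE_def extensional_def)
  have empty: "{P \<in> GL (Suc n). \<forall>r<Suc n. P $$ (r, 0) = v r} = {}" if "v \<in> ?non" for v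
  proof (rule equals0I)
    fix P assume "P \<in> {P \<in> GL (Suc n). \<forall>r<Suc n. P $$ (r, 0) = v r}"
    then have P: "P \<in> carrier_mat (Suc n) (Suc n)" "det P dvd 1" "\<forall>r<Suc n. P $$ (r, 0) = v r"
      by (auto simp: GL_def simp del: GL_carrier)
    obtain \<sigma> where \<sigma>: "\<sigma> permutes {0..<Suc n}" "\<And>i. i < Suc n \<Longrightarrow> P $$ (i, \<sigma> i) dvd 1"
      using unit_det_imp_unit_entries[OF P(1,2)] by blast
    \<comment> \<open>The row that the permutation sends to column 0 has a unit there, which a
      column of nonunits excludes.\<close>
    obtain i where "i < Suc n" "\<sigma> i = 0"
      using permutes_image[OF \<sigma>(1)] by (metis (no_types) atLeastLessThan_iff imageE zero_le zero_less_Suc)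
    then have "v i dvd 1" using \<sigma>(2)[of i] P(3) by simp
    then show False using that \<open>i < Suc n\<close> unit_iff by (auto simp: PiE_def Pi_def)
  qed
  have "card (GL (Suc n) :: 'a mat set) = (\<Sum>v\<in>?all. card {P \<in> GL (Suc n). ?col P = v})"
    by (rule card_eq_sum_card_fibres) (simp_all add: finite_PiE restrict_PiE_iff image_subset_iff)
  also have "\<dots> = (\<Sum>v\<in>?all. card {P \<in> GL (Suc n). \<forall>r<Suc n. P $$ (r, 0) = v r})"
    by (intro sum.cong refl arg_cong[of _ _ card] fibre)
  also have "\<dots> = (\<Sum>v\<in>?all - ?non. card {P \<in> GL (Suc n). \<forall>r<Suc n. P $$ (r, 0) = v r})"
  proof (rule sum.mono_neutral_right)
    show "\<forall>v\<in>?all - (?all - ?non). card {P \<in> GL (Suc n). \<forall>r<Suc n. P $$ (r, 0) = v r} = 0"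
    proof
      fix v assume "v \<in> ?all - (?all - ?non)"
      then have "v \<in> ?non" by blast
      then show "card {P \<in> GL (Suc n). \<forall>r<Suc n. P $$ (r, 0) = v r} = 0"
        unfolding empty[OF \<open>v \<in> ?non\<close>] by simp
    qed
    show "finite ?all" by (intro finite_PiE) auto
  qed blast
  also have "\<dots> = (\<Sum>v\<in>?all - ?non. CARD('a) ^ n * card (GL n :: 'a mat set))"
  proof (rule sum.cong[OF refl], rule card_GL_first_col)
    fix v assume "v \<in> ?all - ?non"
    then show "\<exists>i<Suc n. v i dvd 1" unfolding unit_iff by (auto simp: PiE_def Pi_def)
  qed
  also have "\<dots> = card (?all - ?non) * (CARD('a) ^ n * card (GL n :: 'a mat set))" by simp
  also have "card (?all - ?non) = CARD('a) ^ Suc n - card nonunits ^ Suc n"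
  proof -
    have "?non \<subseteq> ?all" by (intro PiE_mono) auto
    then have "card (?all - ?non) = card ?all - card ?non"
      by (intro card_Diff_subset) (auto intro!: finite_PiE)
    then show ?thesis by (simp add: card_PiE)
  qed
  finally show ?thesis .
qed

lemma card_GL_0: "card (GL 0 :: 'a mat set) = 1"
proof -
  have "GL 0 = {1\<^sub>m 0 :: 'a mat}" by (auto simp: GL_def simp del: GL_carrier)
  then show ?thesis by simp
qed

end

section \<open>Similarity classes of diagonal matrices\<close>

text \<open>Diagonals are kept as lists so that the multiset of eigenvalues is simply
  \<open>mset\<close>.\<close>

definition diag_of_list :: "'a :: zero list \<Rightarrow> 'a mat" where
  "diag_of_list xs = mat_diag (length xs) (\<lambda>i. xs ! i)"

lemma diag_of_list_carrier: "diag_of_list xs \<in> carrier_mat (length xs) (length xs)"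
  by (simp add: diag_of_list_def)

lemma diag_of_list_intertwines_iff:
  assumes P: "P \<in> carrier_mat n n" and len: "length xs = n" "length ys = n"
  shows "diag_of_list xs * P = P * diag_of_list ys
    \<longleftrightarrow> (\<forall>i<n. \<forall>j<n. xs ! i * P $$ (i, j) = P $$ (i, j) * ys ! j)"
  unfolding diag_of_list_def len mat_diag_mult_left[OF P] mat_diag_mult_right[OF P]
  by (auto simp: mat_eq_iff)

lemma similar_diag_of_list_if_mset_eq:
  fixes xs ys :: "'a :: comm_ring_1 list"
  assumes "mset xs = mset ys"
  shows "similar_mat (diag_of_list xs) (diag_of_list ys)"
proof -
  define n where "n = length ys"
  have len: "length xs = n" "length ys = n" using mset_eq_length[OF assms] n_def by auto
  obtain \<sigma> where \<sigma>: "\<sigma> permutes {..<length ys}" "permute_list \<sigma> ys = xs"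
    by (rule mset_eq_permutation[OF assms])
  have \<sigma>': "\<sigma> permutes {0..<n}" using \<sigma>(1) len by (simp add: atLeast0LessThan)
  have nth: "xs ! i = ys ! \<sigma> i" if "i < n" for i
    using permute_list_nth[OF \<sigma>(1)] \<sigma>(2) that len by metis
  \<comment> \<open>The identity with rows permuted by \<open>\<sigma>\<close>: row \<open>i\<close>
    has its 1 in column \<open>\<sigma> i\<close>, which matches the relabelling of the eigenvalues
    in \<open>nth\<close>.\<close>
  define P :: "'a mat" where "P = mat n n (\<lambda>(i, j). 1\<^sub>m n $$ (\<sigma> i, j))"
  have P_carr: "P \<in> carrier_mat n n" by (simp add: P_def)
  have "det P = signof \<sigma>"
    unfolding P_def by (subst det_permute_rows[OF one_carrier_mat \<sigma>']) simp
  then have "P \<in> GL n" using P_carr by (simp add: GL_def sign_def del: GL_carrier)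
  moreover have "diag_of_list xs * P = P * diag_of_list ys"
    unfolding diag_of_list_intertwines_iff[OF P_carr len]
    using permutes_in_image[OF \<sigma>'] by (auto simp: P_def nth)
  ultimately show ?thesis
    using similar_mat_iff_GL[of "diag_of_list xs" n "diag_of_list ys"] diag_of_list_carrier len by metis
qed

definition conj_class :: "'a :: comm_ring_1 list \<Rightarrow> 'a mat set" where
  "conj_class xs = {A \<in> carrier_mat (length xs) (length xs). similar_mat A (diag_of_list xs)}"

lemma finite_conj_class: "finite (conj_class xs :: 'a :: {finite, comm_ring_1} mat set)"
  unfolding conj_class_def by (rule finite_subset[OF _ finite_carrier_mat]) auto

lemma conj_class_cong:
  assumes "mset xs = mset ys"
  shows "conj_class xs = conj_class ys"
proof -
  note sim = similar_diag_of_list_if_mset_eq[OF assms]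
  have "similar_mat A (diag_of_list xs) \<longleftrightarrow> similar_mat A (diag_of_list ys)" for A
    using similar_mat_trans[OF _ sim] similar_mat_trans[OF _ similar_mat_sym[OF sim]] by blast
  then show ?thesis by (simp add: conj_class_def mset_eq_length[OF assms])
qed

lemma card_conj_class:
  fixes xs :: "'a :: {finite, comm_ring_1} list"
  shows "card (conj_class xs) * card (centralizer_GL (diag_of_list xs)) = card (GL (length xs) :: 'a mat set)"
  unfolding conj_class_def by (rule card_conjugacy_class[OF diag_of_list_carrier])

lemma Diag_eq: "Diag n = (\<Union>xs\<in>{xs. length xs = n}. conj_class xs)"
proof (intro equalityI subsetI)
  fix A :: "'a mat" assume "A \<in> Diag n"
  then obtain D where A: "A \<in> carrier_mat n n" and D: "diagonal_mat D" "similar_mat A D"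
    by (auto simp: Diag_def diagonalizable_mat_def)
  \<comment> \<open>The definition of diagonalizability does not mention the size of
    \<open>D\<close>; similarity puts both matrices into one carrier, and \<open>A\<close> fixes its
    dimension.\<close>
  obtain m where "{A, D} \<subseteq> carrier_mat m m" using similar_matD[OF D(2)] by blast
  then have D_carr: "D \<in> carrier_mat n n" using A carrier_matD(1)[of A m m] carrier_matD(1)[OF A] by auto
  then have "diag_of_list (diag_mat D) = D"
    using D(1) by (intro eq_matI) (auto simp: diag_of_list_def mat_diag_def diag_mat_def diagonal_mat_def)
  then have "A \<in> conj_class (diag_mat D)"
    using A D D_carr by (simp add: conj_class_def diag_mat_def)
  then show "A \<in> (\<Union>xs\<in>{xs. length xs = n}. conj_class xs)"
    using D_carr by (intro UN_I[of "diag_mat D"]) (auto simp: diag_mat_def)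
next
  fix A :: "'a mat" assume "A \<in> (\<Union>xs\<in>{xs. length xs = n}. conj_class xs)"
  then obtain xs where "length xs = n" "A \<in> conj_class xs" by blast
  moreover have "diagonal_mat (diag_of_list xs)"
    by (auto simp: diagonal_mat_def diag_of_list_def mat_diag_def)
  ultimately show "A \<in> Diag n" by (auto simp: Diag_def diagonalizable_mat_def conj_class_def)
qed

lemma centralizer_GL_diag_of_list:
  "centralizer_GL (diag_of_list xs)
    = {X \<in> GL (length xs). \<forall>i<length xs. \<forall>j<length xs. (xs ! i - xs ! j) * X $$ (i, j) = 0}"
proof -
  have "diag_of_list xs * X = X * diag_of_list xs
    \<longleftrightarrow> (\<forall>i<length xs. \<forall>j<length xs. (xs ! i - xs ! j) * X $$ (i, j) = 0)"
    if "X \<in> GL (length xs)" for X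
    using diag_of_list_intertwines_iff[OF GL_carrier[OF that] refl refl]
    by (simp add: algebra_simps)
  then show ?thesis using diag_of_list_carrier[of xs] by (auto simp: centralizer_GL_def)
qed

definition annihilator :: "'a :: comm_ring_1 \<Rightarrow> 'a set" where
  "annihilator x = {y. x * y = 0}"

lemma annihilator_minus: "annihilator (x - y) = annihilator (y - x)"
  by (auto simp: annihilator_def left_diff_distrib)

context principal_local_ring
begin

lemma mset_eq_if_similar_diag_of_list:
  fixes xs ys :: "'a list"
  assumes "similar_mat (diag_of_list xs) (diag_of_list ys)" "length xs = length ys"
  shows "mset xs = mset ys"
proof -
  define n where "n = length ys"
  have len: "length xs = n" "length ys = n" using assms n_def by auto
  obtain P where P: "P \<in> GL n" "diag_of_list xs * P = P * diag_of_list ys"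
    using assms(1) similar_mat_iff_GL[of "diag_of_list xs" n "diag_of_list ys"] diag_of_list_carrier len by metis
  have comm: "xs ! i * P $$ (i, j) = P $$ (i, j) * ys ! j" if "i < n" "j < n" for i j
    using diag_of_list_intertwines_iff[OF GL_carrier[OF P(1)] len] P(2) that by simp
  have "det P dvd 1" using P(1) by (rule GL_det)
  then obtain \<sigma> where \<sigma>: "\<sigma> permutes {0..<n}" "\<And>i. i < n \<Longrightarrow> P $$ (i, \<sigma> i) dvd 1"
    using unit_det_imp_unit_entries[OF GL_carrier[OF P(1)]] by blast
  have \<sigma>': "\<sigma> permutes {..<length ys}" using \<sigma>(1) len by (simp add: atLeast0LessThan)
  have "xs ! i = ys ! \<sigma> i" if i: "i < n" for i
  proof -
    have "\<sigma> i < n" using permutes_in_image[OF \<sigma>(1), of i] i by simp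
    obtain u where u: "P $$ (i, \<sigma> i) * u = 1" using \<sigma>(2)[OF i] by (metis dvdE)
    have "xs ! i = xs ! i * P $$ (i, \<sigma> i) * u" by (simp only: mult.assoc u mult_1_right)
    also have "\<dots> = ys ! \<sigma> i * (P $$ (i, \<sigma> i) * u)"
      unfolding comm[OF i \<open>\<sigma> i < n\<close>] by (simp only: ac_simps)
    finally show ?thesis by (simp add: u)
  qed
  then have "xs = permute_list \<sigma> ys"
    using len permute_list_nth[OF \<sigma>'] by (intro nth_equalityI) auto
  then show ?thesis using mset_permute_list[OF \<sigma>'] by simp
qed

lemma mem_conj_class_imp_mset_eq:
  fixes xs ys :: "'a list"
  assumes "A \<in> conj_class xs" "A \<in> conj_class ys"
  shows "mset xs = mset ys"
proof (rule mset_eq_if_similar_diag_of_list)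
  show "similar_mat (diag_of_list xs) (diag_of_list ys)"
    using assms similar_mat_sym similar_mat_trans unfolding conj_class_def by blast
  show "length xs = length ys" using assms by (auto simp: conj_class_def)
qed

text \<open>Double counting of the pairs of a list and a matrix in its class. A matrix determines
  the multiset, so \<open>c\<close> is the number of lists in \<open>T\<close> that enumerate the
  same multiset; it is 1 or 6 in the applications.\<close>

lemma card_Union_conj_class:
  fixes T :: "'a list set"
  assumes "finite T" and "\<And>xs. xs \<in> T \<Longrightarrow> card {ys \<in> T. mset ys = mset xs} = c"
  shows "(\<Sum>xs\<in>T. card (conj_class xs)) = c * card (\<Union>xs\<in>T. conj_class xs)"
proof -
  let ?U = "\<Union>xs\<in>T. conj_class xs"
  have "(\<Sum>xs\<in>T. card {A \<in> ?U. A \<in> conj_class xs}) = c * card ?U"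
  proof (rule sum_multicount)
    show "\<forall>A\<in>?U. card {xs \<in> T. A \<in> conj_class xs} = c"
    proof
      fix A assume "A \<in> ?U"
      then obtain xs where xs: "xs \<in> T" "A \<in> conj_class xs" by blast
      then have "{ys \<in> T. A \<in> conj_class ys} = {ys \<in> T. mset ys = mset xs}"
        using mem_conj_class_imp_mset_eq conj_class_cong by blast
      then show "card {xs \<in> T. A \<in> conj_class xs} = c" using assms(2)[OF xs(1)] by simp
    qed
    show "finite T" "finite ?U" using assms(1) by (auto intro: finite_conj_class)
  qed
  moreover have "{A \<in> ?U. A \<in> conj_class xs} = conj_class xs" if "xs \<in> T" for xs using that by blast
  ultimately show ?thesis by simp
qed

section \<open>Centralizers of diagonal matrices over a local ring\<close>

lemma pi_dvd_if_annihilator: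
  assumes "x \<noteq> 0" "y \<in> annihilator x"
  shows "\<pi> dvd y"
proof (rule ccontr)
  assume "\<not> \<pi> dvd y"
  then obtain u where "1 = y * u" unfolding unit_iff[symmetric] by (elim dvdE)
  then have "x = (x * y) * u" by (metis mult.assoc mult_1_right)
  then show False using assms by (simp add: annihilator_def)
qed

text \<open>Invertibility reduces to unit diagonal entries, so the centralizer is described entry by
  entry with no condition linking two entries, and its size is a product.\<close>

lemma card_centralizer_distinct:
  fixes xs :: "'a list"
  assumes "distinct xs" and len: "length xs = n"
  shows "card (centralizer_GL (diag_of_list xs))
    = (\<Prod>i<n. \<Prod>j<n. card (if i = j then {x. x dvd 1} else annihilator (xs ! i - xs ! j)))"
proof -
  let ?S = "\<lambda>i j. if i = j then {x. x dvd 1} else annihilator (xs ! i - xs ! j)"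
  have "X \<in> centralizer_GL (diag_of_list xs) \<longleftrightarrow> X \<in> carrier_mat n n \<and> (\<forall>i<n. \<forall>j<n. X $$ (i, j) \<in> ?S i j)"
    for X
  proof (cases "X \<in> carrier_mat n n \<and> (\<forall>i<n. \<forall>j<n. (xs ! i - xs ! j) * X $$ (i, j) = 0)")
    case True
    then have carr: "X \<in> carrier_mat n n" by blast
    \<comment> \<open>The diagonal part of \<open>X\<close>. The discarded entries annihilate
      nonzero differences, hence lie in the maximal ideal, and \<open>det X\<close> is congruent to
      \<open>det Y\<close>.\<close>
    define Y where "Y = mat_diag n (\<lambda>i. X $$ (i, i))"
    have Y: "Y \<in> carrier_mat n n" by (simp add: Y_def)
    have "\<pi> dvd X $$ (i, j) - Y $$ (i, j)" if "i < n" "j < n" for i j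
    proof (cases "i = j")
      case False
      then have "xs ! i - xs ! j \<noteq> 0" using assms that by (simp add: nth_eq_iff_index_eq)
      then have "\<pi> dvd X $$ (i, j)"
        using True that by (intro pi_dvd_if_annihilator) (auto simp: annihilator_def)
      then show ?thesis using False that by (simp add: Y_def mat_diag_def)
    qed (use that in \<open>simp add: Y_def mat_diag_def\<close>)
    then have "\<pi> dvd det X \<longleftrightarrow> \<pi> dvd det Y"
      using pi_dvd_cong dvd_det_diff[OF carr Y] by blast
    also have "det Y = (\<Prod>i = 0..<n. X $$ (i, i))"
      using det_upper_triangular[OF _ Y] by (auto simp: prod_list_diag_prod Y_def mat_diag_def upper_triangular_def)
    finally have "det X dvd 1 \<longleftrightarrow> (\<forall>i<n. X $$ (i, i) dvd 1)"
      by (auto simp: unit_iff pi_dvd_prod_iff)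
    then show ?thesis
      using True len by (auto simp: centralizer_GL_diag_of_list annihilator_def GL_def simp del: GL_carrier)
  next
    case False
    then have "X \<notin> centralizer_GL (diag_of_list xs)"
      using len GL_carrier[of X n] by (auto simp: centralizer_GL_diag_of_list)
    moreover have "(xs ! i - xs ! j) * X $$ (i, j) = 0" if "X $$ (i, j) \<in> ?S i j" for i j
      using that by (cases "i = j") (simp_all add: annihilator_def)
    ultimately show ?thesis using False by blast
  qed
  then have "centralizer_GL (diag_of_list xs) = {X \<in> carrier_mat n n. \<forall>i<n. \<forall>j<n. X $$ (i, j) \<in> ?S i j}"
    by blast
  then show ?thesis by (simp only: card_mat_entries)
qed

text \<open>The order \<open>[b, a, a]\<close> puts the repeated eigenvalue into the lower right 2 x
  2 block, which is unconstrained by commutation. The two off-diagonal blocks have four entries in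
  all, each ranging over the annihilator: hence the exponent 4.\<close>

lemma card_centralizer_two_equal:
  fixes a b :: 'a
  assumes "a \<noteq> b"
  shows "card (centralizer_GL (diag_of_list [b, a, a]))
    = card (GL 1 :: 'a mat set) * card (GL 2 :: 'a mat set) * card (annihilator (a - b)) ^ 4"
proof -
  let ?I = "annihilator (a - b)"
  let ?R = "{B \<in> carrier_mat 1 2. \<forall>i<1. \<forall>j<2. B $$ (i, j) \<in> ?I}"
  let ?C = "{B \<in> carrier_mat 2 1. \<forall>i<2. \<forall>j<1. B $$ (i, j) \<in> ?I}"
  let ?F = "\<lambda>(A, B, C, D). four_block_mat A B C D :: 'a mat"
  have main: "four_block_mat A B C D \<in> centralizer_GL (diag_of_list [b, a, a])
      \<longleftrightarrow> A \<in> GL 1 \<and> B \<in> ?R \<and> C \<in> ?C \<and> D \<in> GL 2"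
    if "A \<in> carrier_mat 1 1" "B \<in> carrier_mat 1 2" "C \<in> carrier_mat 2 1" "D \<in> carrier_mat 2 2"
    for A B C D :: "'a mat"
  proof -
    \<comment> \<open>\<open>?Y\<close> drops the off-diagonal blocks, so its determinant is
      \<open>det A * det D\<close> and agrees with that of \<open>?X\<close> modulo
      \<open>\<pi>\<close>.\<close>
    let ?X = "four_block_mat A B C D" and ?Y = "four_block_mat A (0\<^sub>m 1 2) (0\<^sub>m 2 1) D"
    have carr: "?X \<in> carrier_mat 3 3" "?Y \<in> carrier_mat 3 3"
      using four_block_carrier_mat[OF that(1,4)] by (simp_all add: numeral_3_eq_3)
    have entries: "(\<forall>i<3. \<forall>j<3. ([b, a, a] ! i - [b, a, a] ! j) * ?X $$ (i, j) = 0) \<longleftrightarrow> B \<in> ?R \<and> C \<in> ?C"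
      using that by (auto simp: less_Suc_eq numeral_3_eq_3 numeral_2_eq_2 annihilator_def left_diff_distrib)
    have "?X \<in> GL 3 \<longleftrightarrow> A \<in> GL 1 \<and> D \<in> GL 2" if "B \<in> ?R" "C \<in> ?C"
    proof -
      have "\<pi> dvd ?X $$ (i, j) - ?Y $$ (i, j)" if "i < 3" "j < 3" for i j
        using that \<open>A \<in> carrier_mat 1 1\<close> \<open>B \<in> ?R\<close> \<open>C \<in> ?C\<close> \<open>D \<in> carrier_mat 2 2\<close> assms
        by (auto simp: less_Suc_eq numeral_3_eq_3 numeral_2_eq_2 intro!: pi_dvd_if_annihilator[of "a - b"])
      then have "\<pi> dvd det ?X \<longleftrightarrow> \<pi> dvd det ?Y"
        using pi_dvd_cong dvd_det_diff[OF carr] by blast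
      also have "det ?Y = det A * det D"
        using det_four_block_mat_lower_left_zero_col[OF \<open>A \<in> carrier_mat 1 1\<close> _ refl \<open>D \<in> carrier_mat 2 2\<close>]
        by simp
      finally show ?thesis
        using carr \<open>A \<in> carrier_mat 1 1\<close> \<open>D \<in> carrier_mat 2 2\<close>
        by (simp add: GL_def unit_iff pi_dvd_mult_iff del: GL_carrier)
    qed
    then show ?thesis
      using entries by (auto simp: centralizer_GL_diag_of_list numeral_3_eq_3)
  qed
  have image: "?F ` (GL 1 \<times> ?R \<times> ?C \<times> GL 2) = centralizer_GL (diag_of_list [b, a, a])"
  proof (intro equalityI subsetI)
    fix X assume "X \<in> ?F ` (GL 1 \<times> ?R \<times> ?C \<times> GL 2)"
    then obtain A B C D where "X = four_block_mat A B C D" "A \<in> GL 1" "B \<in> ?R" "C \<in> ?C" "D \<in> GL 2"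
      by auto
    then show "X \<in> centralizer_GL (diag_of_list [b, a, a])"
      using main[of A B C D] GL_carrier by blast
  next
    fix X assume X: "X \<in> centralizer_GL (diag_of_list [b, a, a])"
    then have "X \<in> carrier_mat (1 + 2) (1 + 2)"
      using GL_carrier[of X 3] by (simp add: centralizer_GL_diag_of_list numeral_3_eq_3)
    then obtain A B C D where "A \<in> carrier_mat 1 1" "B \<in> carrier_mat 1 2" "C \<in> carrier_mat 2 1"
      "D \<in> carrier_mat 2 2" "X = four_block_mat A B C D"
      by (rule four_block_mat_cases)
    with main[of A B C D] X show "X \<in> ?F ` (GL 1 \<times> ?R \<times> ?C \<times> GL 2)"
      by (intro image_eqI[of _ _ "(A, B, C, D)"]) auto
  qed
  have inj: "inj_on ?F (GL 1 \<times> ?R \<times> ?C \<times> GL 2)"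
    by (rule inj_on_subset[OF bij_betw_imp_inj_on[OF bij_betw_four_block_mat[of 1 1 2 2]]])
      (auto dest: GL_carrier simp del: One_nat_def)
  have "card (centralizer_GL (diag_of_list [b, a, a])) 
      = card ((GL 1 :: 'a mat set) \<times> ?R \<times> ?C \<times> (GL 2 :: 'a mat set))"
    unfolding image[symmetric] by (rule card_image[OF inj])
  also have "\<dots> = card (GL 1 :: 'a mat set) * (card ?R * (card ?C * card (GL 2 :: 'a mat set)))"
    by (simp only: card_cartesian_product)
  also have "card ?R = card ?I ^ 2"
    unfolding card_mat_entries[of 1 2 "\<lambda>_ _. ?I"] by (simp only: prod_constant card_lessThan power_one_right)
  also have "card ?C = card ?I ^ 2"
    unfolding card_mat_entries[of 2 1 "\<lambda>_ _. ?I"] by (simp only: prod_constant card_lessThan power_one_right)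
  also have "card (GL 1 :: 'a mat set) * (card ?I ^ 2 * (card ?I ^ 2 * card (GL 2 :: 'a mat set)))
      = card (GL 1 :: 'a mat set) * card (GL 2 :: 'a mat set) * card ?I ^ 4"
    by (simp only: ac_simps power4_eq_xxxx power2_eq_square)
  finally show ?thesis .
qed

end

section \<open>Valuations in finite chain rings\<close>

text \<open>The chain of ideals generated by the powers of \<open>\<pi>\<close> is recorded by its
  sizes: \<open>i = 0\<close> gives the order \<open>p ^ k\<close> of the ring, and
  \<open>i = k\<close> says that \<open>\<pi> ^ k\<close> vanishes. So \<open>p\<close> is the order
  of the residue field and \<open>k\<close> the length of the chain.\<close>

locale finite_chain_ring = principal_local_ring \<pi> for \<pi> :: "'a :: {finite, comm_ring_1}" +
  fixes p k :: nat
  assumes p_gt_1: "p > 1" and k_pos: "k > 0"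
    and card_multiples: "i \<le> k \<Longrightarrow> card {x. \<pi> ^ i dvd x} = p ^ (k - i)"
begin

lemma card_ring: "CARD('a) = p ^ k"
  using card_multiples[of 0] by simp

lemma pi_pow_k_dvd_iff: "\<pi> ^ k dvd x \<longleftrightarrow> x = 0"
proof -
  have "card {x. \<pi> ^ k dvd x} = 1" using card_multiples[of k] by simp
  then obtain z where z: "{x. \<pi> ^ k dvd x} = {z}" by (rule card_1_singletonE)
  then have "z = 0" by (metis (mono_tags) dvd_0_right mem_Collect_eq singletonD)
  then show ?thesis using z by blast
qed

text \<open>\<^term>\<open>val 0\<close> is a junk value: every power of \<open>\<pi>\<close> divides \<open>0\<close>.\<close>

definition val :: "'a \<Rightarrow> nat" where
  "val x = (LEAST i. \<not> \<pi> ^ Suc i dvd x)"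

lemma
  assumes "x \<noteq> 0"
  shows val_less: "val x < k" and pi_pow_dvd_iff: "\<pi> ^ j dvd x \<longleftrightarrow> j \<le> val x"
proof -
  \<comment> \<open>Here \<open>Suc (k - 1)\<close> is \<open>k\<close>, as \<open>k\<close> is
    positive. This exponent shows that the \<open>LEAST\<close> in \<open>val\<close> exists and is
    at most \<open>k - 1\<close>.\<close>
  have ex: "\<not> \<pi> ^ Suc (k - 1) dvd x" using assms k_pos pi_pow_k_dvd_iff by simp
  have "val x \<le> k - 1" unfolding val_def by (rule Least_le[of "\<lambda>i. \<not> \<pi> ^ Suc i dvd x", OF ex])
  then show "val x < k" using k_pos by simp
  have not_dvd: "\<not> \<pi> ^ Suc (val x) dvd x"
    unfolding val_def by (rule LeastI[of "\<lambda>i. \<not> \<pi> ^ Suc i dvd x", OF ex])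
  have dvd: "\<pi> ^ Suc i dvd x" if "i < val x" for i
    using not_less_Least[of i "\<lambda>i. \<not> \<pi> ^ Suc i dvd x"] that unfolding val_def by blast
  show "\<pi> ^ j dvd x \<longleftrightarrow> j \<le> val x"
  proof
    assume "\<pi> ^ j dvd x"
    then show "j \<le> val x"
      using not_dvd le_imp_power_dvd[of "Suc (val x)" j \<pi>] by (metis dvd_trans not_less_eq_eq)
  next
    assume "j \<le> val x"
    then show "\<pi> ^ j dvd x" using dvd[of "j - 1"] by (cases j) auto
  qed
qed

lemma val_eqI:
  assumes "\<pi> ^ i dvd x" "\<not> \<pi> ^ Suc i dvd x"
  shows "x \<noteq> 0" "val x = i"
proof -
  show "x \<noteq> 0" using assms(2) by auto
  then show "val x = i" using assms pi_pow_dvd_iff by (metis le_antisym not_less_eq_eq)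
qed

lemma val_minus_commute: "val (x - y) = val (y - x)"
  unfolding val_def by (metis dvd_minus_iff minus_diff_eq)

lemma val_diff_eq_left:
  assumes "x \<noteq> 0" "y \<noteq> 0" "val x < val y"
  shows "x \<noteq> y" "val (x - y) = val x"
proof -
  have "\<pi> ^ val x dvd x - y"
    using assms by (intro dvd_diff) (simp_all add: pi_pow_dvd_iff)
  moreover have "\<not> \<pi> ^ Suc (val x) dvd x - y"
  proof
    assume "\<pi> ^ Suc (val x) dvd x - y"
    moreover have "\<pi> ^ Suc (val x) dvd y" using assms pi_pow_dvd_iff[of y "Suc (val x)"] by simp
    ultimately have "\<pi> ^ Suc (val x) dvd (x - y) + y" by (rule dvd_add)
    then show False using pi_pow_dvd_iff[OF assms(1), of "Suc (val x)"] by simp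
  qed
  ultimately show "x \<noteq> y" "val (x - y) = val x" using val_eqI by fastforce+
qed

lemma val_diff_ge:
  assumes "x \<noteq> 0" "y \<noteq> 0" "x \<noteq> y" "val x = val y"
  shows "val x \<le> val (x - y)"
proof -
  have "\<pi> ^ val x dvd x - y"
    using assms by (intro dvd_diff) (simp_all add: pi_pow_dvd_iff)
  then show ?thesis using assms pi_pow_dvd_iff[of "x - y"] by simp
qed

abbreviation level :: "nat \<Rightarrow> 'a set" where
  "level i \<equiv> {x. x \<noteq> 0 \<and> val x = i}"

lemma level_eq: "level i = {x. \<pi> ^ i dvd x} - {x. \<pi> ^ Suc i dvd x}"
proof (intro equalityI subsetI)
  fix x assume x: "x \<in> level i"
  then show "x \<in> {x. \<pi> ^ i dvd x} - {x. \<pi> ^ Suc i dvd x}"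
    using pi_pow_dvd_iff[of x i] pi_pow_dvd_iff[of x "Suc i"] by simp
qed (use val_eqI in blast)

lemma card_level:
  assumes "i < k"
  shows "real (card (level i)) = (real p - 1) * real p ^ (k - Suc i)"
proof -
  have sub: "{x. \<pi> ^ Suc i dvd x} \<subseteq> {x. \<pi> ^ i dvd x}"
    using dvd_mult_right by (auto simp: power_Suc)
  have "card (level i) = p ^ (k - i) - p ^ (k - Suc i)"
    unfolding level_eq using assms sub by (subst card_Diff_subset) (simp_all only: card_multiples finite less_imp_le Suc_leI)
  moreover have "p ^ (k - i) = p * p ^ (k - Suc i)" using assms by (simp add: Suc_diff_Suc flip: power_Suc)
  moreover have "p ^ (k - Suc i) \<le> p * p ^ (k - Suc i)" using p_gt_1 by simp
  ultimately show ?thesis by (simp add: of_nat_diff algebra_simps)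
qed

text \<open>The multiples of \<open>\<pi> ^ i\<close> split into \<open>p\<close> cosets of the
  multiples of \<open>\<pi> ^ Suc i\<close>. The element \<open>y\<close> must avoid the zero coset
  and the coset of \<open>x\<close>; this is the origin of the factor \<open>p - 2\<close>.\<close>

lemma card_level_pair:
  assumes "i < k" "x \<in> level i"
  shows "real (card {y. y \<in> level i \<and> x \<noteq> y \<and> val (x - y) = i}) = (real p - 2) * real p ^ (k - Suc i)"
proof -
  let ?M = "{y. \<pi> ^ Suc i dvd y}" and ?Mx = "{y. \<pi> ^ Suc i dvd x - y}"
  have "{y. y \<in> level i \<and> x \<noteq> y \<and> val (x - y) = i} = {y. y \<in> level i \<and> x - y \<in> level i}" by auto
  also have "\<dots> = level i - ?Mx"
  proof -
    have "\<pi> ^ i dvd x - y" if "y \<in> level i" for y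
      using that assms(2) unfolding level_eq by auto
    then show ?thesis unfolding level_eq by blast
  qed
  finally have eq: "{y. y \<in> level i \<and> x \<noteq> y \<and> val (x - y) = i} = level i - ?Mx" .
  have sub: "?Mx \<subseteq> level i"
  proof
    fix y assume y: "y \<in> ?Mx"
    then have i_dvd: "\<pi> ^ i dvd x - y" using dvd_mult_right by (auto simp: power_Suc)
    have x: "\<pi> ^ i dvd x" "\<not> \<pi> ^ Suc i dvd x" using assms(2) unfolding level_eq by auto
    have "\<pi> ^ i dvd x - (x - y)" using x(1) i_dvd by (rule dvd_diff)
    then have "\<pi> ^ i dvd y" by simp
    moreover have "\<not> \<pi> ^ Suc i dvd y"
      using x(2) y dvd_add[of "\<pi> ^ Suc i" "x - y" y] by (auto simp del: power_Suc)
    ultimately show "y \<in> level i" unfolding level_eq by simp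
  qed
  \<comment> \<open>The reflection \<open>y\<close> to \<open>x - y\<close> is its own inverse and
    exchanges the two sets.\<close>
  have "card ?Mx = card ?M"
    by (rule bij_betw_same_card[of "\<lambda>y. x - y"], rule bij_betwI[where g = "\<lambda>y. x - y"]) (auto simp del: power_Suc)
  then have "card ?Mx = p ^ (k - Suc i)" using assms(1) card_multiples[of "Suc i"] by (simp del: power_Suc)
  moreover have "card (level i - ?Mx) = card (level i) - card ?Mx"
    using sub by (intro card_Diff_subset) auto
  moreover have "card ?Mx \<le> card (level i)" using sub by (intro card_mono) auto
  ultimately show ?thesis
    unfolding eq using card_level[OF assms(1)] by (simp add: of_nat_diff algebra_simps)
qed

text \<open>Up to a unit, \<open>x\<close> is \<open>\<pi> ^ val x\<close>. Multiplication by this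
  power maps the ring onto the \<open>p ^ (k - val x)\<close> multiples of the power, and every
  fibre is a translate of the annihilator.\<close>

lemma card_annihilator:
  assumes "x \<noteq> 0"
  shows "card (annihilator x) = p ^ val x"
proof -
  let ?i = "val x"
  obtain u where u: "x = \<pi> ^ ?i * u" using pi_pow_dvd_iff[OF assms, of ?i] by (auto elim: dvdE)
  have "\<not> \<pi> dvd u"
  proof
    assume "\<pi> dvd u"
    then have "\<pi> ^ Suc ?i dvd x"
      using mult_dvd_mono[of "\<pi> ^ ?i" "\<pi> ^ ?i" \<pi> u] u by (simp add: mult.commute)
    then show False using pi_pow_dvd_iff[OF assms, of "Suc ?i"] by simp
  qed
  then obtain w where w: "1 = u * w" unfolding unit_iff[symmetric] by (elim dvdE)
  have "x * y = 0 \<longleftrightarrow> \<pi> ^ ?i * y = 0" for y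
  proof
    assume "x * y = 0"
    then have "(x * y) * w = 0" by simp
    then have "\<pi> ^ ?i * y * (u * w) = 0" by (subst (asm) u) (simp add: ac_simps)
    then show "\<pi> ^ ?i * y = 0" unfolding w[symmetric] by simp
  next
    assume "\<pi> ^ ?i * y = 0"
    then have "(\<pi> ^ ?i * y) * u = 0" by simp
    then show "x * y = 0" by (subst u) (simp add: ac_simps)
  qed
  then have ann: "annihilator x = {y. \<pi> ^ ?i * y = 0}" by (simp add: annihilator_def)
  have "card (UNIV :: 'a set) = (\<Sum>b\<in>{b. \<pi> ^ ?i dvd b}. card {y \<in> UNIV. \<pi> ^ ?i * y = b})"
    by (rule card_eq_sum_card_fibres) auto
  also have "\<dots> = (\<Sum>b\<in>{b. \<pi> ^ ?i dvd b}. card (annihilator x))"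
  proof (rule sum.cong[OF refl])
    fix b assume "b \<in> {b. \<pi> ^ ?i dvd b}"
    then obtain c where c: "b = \<pi> ^ ?i * c" by (auto elim: dvdE)
    have "bij_betw (\<lambda>y. y - c) {y \<in> UNIV. \<pi> ^ ?i * y = b} (annihilator x)"
      unfolding ann c by (rule bij_betwI[where g = "\<lambda>y. y + c"]) (auto simp: algebra_simps)
    then show "card {y \<in> UNIV. \<pi> ^ ?i * y = b} = card (annihilator x)" by (rule bij_betw_same_card)
  qed
  finally have "p ^ k = p ^ (k - ?i) * card (annihilator x)"
    using card_multiples[of ?i] val_less[OF assms] card_ring by simp
  moreover have "p ^ k = p ^ (k - ?i) * p ^ ?i"
    using val_less[OF assms] by (simp flip: power_add)
  ultimately show ?thesis using p_gt_1 by simp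
qed

section \<open>Sums over one or two valuations\<close>

lemma sum_over_levels:
  fixes f :: "'a \<Rightarrow> real"
  shows "(\<Sum>x | x \<noteq> 0. f x) = (\<Sum>i<k. \<Sum>x\<in>level i. f x)"
proof -
  have "(\<Sum>i<k. \<Sum>x\<in>{x \<in> {x. x \<noteq> 0}. val x = i}. f x) = (\<Sum>x | x \<noteq> 0. f x)"
    by (rule sum.group) (auto simp: val_less)
  then show ?thesis by simp
qed

lemma sum_val:
  fixes f :: "nat \<Rightarrow> real"
  shows "(\<Sum>x | x \<noteq> 0. f (val x)) = (\<Sum>i<k. (real p - 1) * real p ^ (k - Suc i) * f i)"
proof -
  have "(\<Sum>x\<in>level i. f (val x)) = (real p - 1) * real p ^ (k - Suc i) * f i" if "i < k" for i
    using card_level[OF that] by simp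
  then show ?thesis unfolding sum_over_levels by (intro sum.cong) auto
qed

text \<open>Triples of distinct eigenvalues up to translation: \<open>(a, b, c)\<close> corresponds
  to \<open>x = a - b\<close> and \<open>y = a - c\<close>, and then \<open>b - c\<close> is
  \<open>y - x\<close>.\<close>

definition nonzero_pairs :: "('a \<times> 'a) set" where
  "nonzero_pairs = {(x, y). x \<noteq> 0 \<and> y \<noteq> 0 \<and> x \<noteq> y}"

text \<open>
  Of the valuations of \<open>x\<close>, \<open>y\<close> and \<open>x - y\<close> either all agree, or exactly one exceeds the other two.
  The involutions \<open>(x, y) \<mapsto> (y, x)\<close> and \<open>(x, y) \<mapsto> (x, x - y)\<close> permute the three possibilities
  of the latter kind, hence the factor \<open>3\<close>.
\<close>

lemma sum_nonzero_pairs: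
  fixes F :: "nat \<Rightarrow> nat \<Rightarrow> nat \<Rightarrow> real"
  assumes sym: "\<And>i j l. F i j l = F j i l" "\<And>i j l. F i j l = F i l j"
  shows "(\<Sum>(x, y)\<in>nonzero_pairs. F (val x) (val y) (val (x - y)))
    = (\<Sum>i<k. (real p - 1) * (real p - 2) * real p ^ (2 * (k - Suc i)) * F i i i)
      + 3 * (\<Sum>i<k. \<Sum>j\<in>{i<..<k}. (real p - 1) ^ 2 * real p ^ (k - Suc i) * real p ^ (k - Suc j) * F i i j)"
proof -
  let ?f = "\<lambda>(x, y). F (val x) (val y) (val (x - y))"
  let ?E = "{(x, y) \<in> nonzero_pairs. val x = val y \<and> val (x - y) = val x}"
  let ?E1 = "{(x, y) \<in> nonzero_pairs. val x < val y}"
  let ?E2 = "{(x, y) \<in> nonzero_pairs. val y < val x}"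
  let ?E3 = "{(x, y) \<in> nonzero_pairs. val x < val (x - y)}"
  let ?B = "\<Sum>i<k. \<Sum>j\<in>{i<..<k}. (real p - 1) ^ 2 * real p ^ (k - Suc i) * real p ^ (k - Suc j) * F i i j"
  \<comment> \<open>Writing \<open>y\<close> as \<open>x - (x - y)\<close>, the term of smaller
    valuation dominates.\<close>
  have E3_eq: "val y = val x" if "(x, y) \<in> ?E3" for x y
    using that val_diff_eq_left[of x "x - y"] by (auto simp: nonzero_pairs_def)
  have E1: "sum ?f ?E1 = ?B"
  proof -
    have "?E1 = Sigma {x. x \<noteq> 0} (\<lambda>x. {y. y \<noteq> 0 \<and> val x < val y})"
      by (auto simp: nonzero_pairs_def)
    then have "sum ?f ?E1 = (\<Sum>x | x \<noteq> 0. \<Sum>y | y \<noteq> 0 \<and> val x < val y. F (val x) (val y) (val (x - y)))"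
      by (simp add: sum.Sigma)
    also have "\<dots> = (\<Sum>x | x \<noteq> 0. \<Sum>y | y \<noteq> 0. if val x < val y then F (val x) (val x) (val y) else 0)"
    proof (rule sum.cong[OF refl])
      fix x :: 'a assume x: "x \<in> {x. x \<noteq> 0}"
      have "(\<Sum>y | y \<noteq> 0 \<and> val x < val y. F (val x) (val y) (val (x - y)))
          = (\<Sum>y | y \<noteq> 0 \<and> val x < val y. F (val x) (val x) (val y))"
        using x by (intro sum.cong refl) (simp add: val_diff_eq_left sym(2))
      also have "\<dots> = (\<Sum>y | y \<noteq> 0. if val x < val y then F (val x) (val x) (val y) else 0)"
        using sum.inter_filter[of "{y. y \<noteq> 0}" "\<lambda>y. F (val x) (val x) (val y)" "\<lambda>y. val x < val y"] by simp
      finally show "(\<Sum>y | y \<noteq> 0 \<and> val x < val y. F (val x) (val y) (val (x - y)))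
          = (\<Sum>y | y \<noteq> 0. if val x < val y then F (val x) (val x) (val y) else 0)" .
    qed
    also have "\<dots> = (\<Sum>i<k. (real p - 1) * real p ^ (k - Suc i) *
        (\<Sum>j<k. (real p - 1) * real p ^ (k - Suc j) * (if i < j then F i i j else 0)))"
      by (simp only: sum_val[where f = "\<lambda>j. if val _ < j then F (val _) (val _) j else 0"]
          sum_val[where f = "\<lambda>i. \<Sum>j<k. (real p - 1) * real p ^ (k - Suc j) * (if i < j then F i i j else 0)"])
    also have "\<dots> = ?B"
    proof (rule sum.cong[OF refl])
      fix i assume "i \<in> {..<k}"
      have "(\<Sum>j<k. (real p - 1) * real p ^ (k - Suc j) * (if i < j then F i i j else 0))
          = (\<Sum>j\<in>{i<..<k}. (real p - 1) * real p ^ (k - Suc j) * F i i j)"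
        by (intro sum.mono_neutral_cong_right) auto
      then show "(real p - 1) * real p ^ (k - Suc i) *
            (\<Sum>j<k. (real p - 1) * real p ^ (k - Suc j) * (if i < j then F i i j else 0))
          = (\<Sum>j\<in>{i<..<k}. (real p - 1) ^ 2 * real p ^ (k - Suc i) * real p ^ (k - Suc j) * F i i j)"
        by (simp add: sum_distrib_left power2_eq_square ac_simps)
    qed
    finally show ?thesis .
  qed
  have E2: "sum ?f ?E2 = ?B"
    unfolding E1[symmetric]
    by (rule sum.reindex_bij_witness[where i = "\<lambda>(x, y). (y, x)" and j = "\<lambda>(x, y). (y, x)"])
      (auto simp: nonzero_pairs_def val_minus_commute sym(1))
  have E3: "sum ?f ?E3 = ?B"
    unfolding E1[symmetric]
    by (rule sum.reindex_bij_witness[where i = "\<lambda>(x, y). (x, x - y)" and j = "\<lambda>(x, y). (x, x - y)"])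
      (auto simp: nonzero_pairs_def sym(2))
  have E: "sum ?f ?E = (\<Sum>i<k. (real p - 1) * (real p - 2) * real p ^ (2 * (k - Suc i)) * F i i i)"
  proof -
    let ?S = "\<lambda>x. {y. y \<in> level (val x) \<and> x \<noteq> y \<and> val (x - y) = val x}"
    have "?E = Sigma {x. x \<noteq> 0} ?S"
      by (auto simp: nonzero_pairs_def)
    moreover have "sum ?f (Sigma {x. x \<noteq> 0} ?S) = (\<Sum>x | x \<noteq> 0. \<Sum>y\<in>?S x. F (val x) (val y) (val (x - y)))"
      by (rule sum.Sigma[symmetric]) auto
    ultimately have "sum ?f ?E = (\<Sum>x | x \<noteq> 0. \<Sum>y\<in>?S x. F (val x) (val y) (val (x - y)))"
      by (simp only:)
    also have "\<dots> = (\<Sum>x | x \<noteq> 0. real (card (?S x)) * F (val x) (val x) (val x))"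
      by simp
    also have "\<dots> = (\<Sum>x | x \<noteq> 0. (real p - 2) * real p ^ (k - Suc (val x)) * F (val x) (val x) (val x))"
      using card_level_pair val_less by (intro sum.cong refl) simp
    also have "\<dots> = (\<Sum>i<k. (real p - 1) * real p ^ (k - Suc i) * ((real p - 2) * real p ^ (k - Suc i) * F i i i))"
      by (rule sum_val)
    also have "\<dots> = (\<Sum>i<k. (real p - 1) * (real p - 2) * real p ^ (2 * (k - Suc i)) * F i i i)"
      by (simp only: mult_2 power_add ac_simps)
    finally show ?thesis .
  qed
  \<comment> \<open>If \<open>val x = val y\<close>, the difference cannot have smaller valuation,
    so it falls into \<open>?E\<close> or \<open>?E3\<close>.\<close>
  have split: "nonzero_pairs = ?E \<union> ?E1 \<union> ?E2 \<union> ?E3"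
    using val_diff_ge by (fastforce simp: nonzero_pairs_def)
  have fin: "finite ?E" "finite ?E1" "finite ?E2" "finite ?E3" by auto
  have "sum ?f nonzero_pairs = sum ?f (?E \<union> ?E1 \<union> ?E2 \<union> ?E3)"
    using split by (rule arg_cong)
  also have "\<dots> = sum ?f (?E \<union> ?E1 \<union> ?E2) + sum ?f ?E3"
  proof (intro sum.union_disjoint finite_UnI fin)
    have False if "(x, y) \<in> ?E \<union> ?E1 \<union> ?E2" "(x, y) \<in> ?E3" for x y
      using that E3_eq[OF that(2)] by (elim UnE) simp_all
    then show "(?E \<union> ?E1 \<union> ?E2) \<inter> ?E3 = {}" by blast
  qed
  also have "sum ?f (?E \<union> ?E1 \<union> ?E2) = sum ?f (?E \<union> ?E1) + sum ?f ?E2"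
    by (intro sum.union_disjoint finite_UnI fin) auto
  also have "sum ?f (?E \<union> ?E1) = sum ?f ?E + sum ?f ?E1"
    by (intro sum.union_disjoint finite_UnI fin) auto
  finally have "sum ?f nonzero_pairs = sum ?f ?E + sum ?f ?E1 + sum ?f ?E2 + sum ?f ?E3" .
  then show ?thesis unfolding E E1 E2 E3 by simp
qed

end

section \<open>Counting the classes of three by three matrices\<close>

text \<open>With \<open>q\<close> and \<open>m\<close> the orders of residue field and maximal
  ideal, these are the quotients of the order of GL_3 by that of GL_1 x GL_2 and by the cube of the
  number of units, written without division.\<close>

lemma card_GL_quotients:
  fixes q m :: real
  shows "(q ^ 3 - 1) * m ^ 3 * (q * m) ^ 2 * ((q ^ 2 - 1) * m ^ 2 * (q * m) * ((q - 1) * m))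
      = m ^ 4 * q ^ 2 * (q ^ 2 + q + 1) * ((q - 1) * m * ((q ^ 2 - 1) * m ^ 2 * (q * m) * ((q - 1) * m)))"
    and "(q ^ 3 - 1) * m ^ 3 * (q * m) ^ 2 * ((q ^ 2 - 1) * m ^ 2 * (q * m) * ((q - 1) * m))
      = m ^ 6 * q ^ 3 * (q + 1) * (q ^ 2 + q + 1) * ((q - 1) * m) ^ 3"
proof -
  have factor: "q ^ 3 - 1 = (q - 1) * (q ^ 2 + q + 1)" "q ^ 2 - 1 = (q - 1) * (q + 1)"
    by (simp_all add: algebra_simps power2_eq_square power3_eq_cube)
  \<comment> \<open>Numeral powers are unrolled into products, so that rearranging factors suffices
    to match both sides.\<close>
  note expand = eval_nat_numeral BitM.simps One_nat_def power_Suc power_0 mult_1_left mult_1_right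
  show "(q ^ 3 - 1) * m ^ 3 * (q * m) ^ 2 * ((q ^ 2 - 1) * m ^ 2 * (q * m) * ((q - 1) * m))
      = m ^ 4 * q ^ 2 * (q ^ 2 + q + 1) * ((q - 1) * m * ((q ^ 2 - 1) * m ^ 2 * (q * m) * ((q - 1) * m)))"
    unfolding factor(1) by (simp only: expand ac_simps)
  show "(q ^ 3 - 1) * m ^ 3 * (q * m) ^ 2 * ((q ^ 2 - 1) * m ^ 2 * (q * m) * ((q - 1) * m))
      = m ^ 6 * q ^ 3 * (q + 1) * (q ^ 2 + q + 1) * ((q - 1) * m) ^ 3"
    unfolding factor by (simp only: expand ac_simps)
qed

text \<open>The repeated eigenvalue is recognizable as the only element of multiplicity 2.\<close>

lemma mset_two_equal_eqD:
  assumes "mset [b, a, a] = mset [d, c, c]" "a \<noteq> b" "c \<noteq> d"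
  shows "a = c" "b = d"
proof -
  have "count (mset [b, a, a]) a = 2" using assms(2) by simp
  then have "count (mset [d, c, c]) a = 2" unfolding assms(1) .
  then show "a = c" using assms(3) by (simp split: if_splits)
  then show "b = d" using assms(1) by simp
qed

context finite_chain_ring
begin

text \<open>The orders of the residue field and of the maximal ideal.\<close>

abbreviation "q \<equiv> real p"
abbreviation "m \<equiv> real p ^ (k - 1)"

lemma q_power_k: "q ^ k = q * m"
  using k_pos by (simp flip: power_Suc)

lemma real_card_ring: "real CARD('a) = q * m"
  using q_power_k by (simp add: card_ring)

lemma card_nonunits: "card nonunits = p ^ (k - 1)"
  using card_multiples[of 1] k_pos by simp

lemma real_card_units: "real (card {x :: 'a. x dvd 1}) = (q - 1) * m"
proof -
  have "{x :: 'a. x dvd 1} = UNIV - nonunits" using unit_iff by blast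
  then have "card {x :: 'a. x dvd 1} = CARD('a) - card nonunits" by (simp add: card_Diff_subset)
  moreover have "card nonunits \<le> CARD('a)" by (simp add: card_mono)
  ultimately have "real (card {x :: 'a. x dvd 1}) = real CARD('a) - real (card nonunits)"
    by (simp add: of_nat_diff)
  then show ?thesis unfolding real_card_ring card_nonunits by (simp add: algebra_simps)
qed

lemma real_card_GL_Suc:
  "real (card (GL (Suc n) :: 'a mat set))
    = (q ^ Suc n - 1) * m ^ Suc n * (q * m) ^ n * real (card (GL n :: 'a mat set))"
proof -
  have "card nonunits ^ Suc n \<le> CARD('a) ^ Suc n" by (intro power_mono card_mono) auto
  then have "real (card (GL (Suc n) :: 'a mat set))
      = (real CARD('a) ^ Suc n - real (card nonunits) ^ Suc n) * (real CARD('a) ^ n * real (card (GL n :: 'a mat set)))"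
    unfolding card_GL_Suc by (simp only: of_nat_mult of_nat_diff of_nat_power)
  also have "real CARD('a) ^ Suc n - real (card nonunits) ^ Suc n = (q ^ Suc n - 1) * m ^ Suc n"
    unfolding real_card_ring card_nonunits of_nat_power power_mult_distrib by (simp only: left_diff_distrib mult_1)
  finally show ?thesis by (simp only: real_card_ring mult.assoc)
qed

lemma real_card_GL_1: "real (card (GL 1 :: 'a mat set)) = (q - 1) * m"
  using real_card_GL_Suc[of 0] card_GL_0 by simp

lemma real_card_GL_2: "real (card (GL 2 :: 'a mat set)) = (q ^ 2 - 1) * m ^ 2 * (q * m) * ((q - 1) * m)"
  using real_card_GL_Suc[of 1] unfolding real_card_GL_1 by (simp add: numeral_2_eq_2)

lemma real_card_GL_3:
  "real (card (GL 3 :: 'a mat set))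
    = (q ^ 3 - 1) * m ^ 3 * (q * m) ^ 2 * ((q ^ 2 - 1) * m ^ 2 * (q * m) * ((q - 1) * m))"
  using real_card_GL_Suc[of 2] unfolding real_card_GL_2 by (simp add: numeral_3_eq_3)

lemma q_gt_1: "q > 1" and m_pos: "m > 0"
  using p_gt_1 by simp_all

lemma card_annihilator_diff: "x \<noteq> y \<Longrightarrow> real (card (annihilator (x - y))) = q ^ val (x - y)"
  by (simp add: card_annihilator)

lemma card_conj_class_scalar: "card (conj_class [a, a, a :: 'a]) = 1"
proof -
  have "centralizer_GL (diag_of_list [a, a, a]) = GL 3"
    unfolding centralizer_GL_diag_of_list by (auto simp: less_Suc_eq numeral_3_eq_3)
  then have "card (conj_class [a, a, a]) * card (GL 3 :: 'a mat set) = card (GL 3 :: 'a mat set)"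
    using card_conj_class[of "[a, a, a]"] by (simp add: numeral_3_eq_3)
  moreover have "card (GL 3 :: 'a mat set) > 0"
  proof -
    have "1\<^sub>m 3 \<in> (GL 3 :: 'a mat set)" by (simp add: GL_def del: GL_carrier)
    then show ?thesis by (auto simp: card_gt_0_iff)
  qed
  ultimately show ?thesis by (metis gr_implies_not0 mult_1 mult_cancel2)
qed

text \<open>The constant is the class size for a unit difference; each further step of valuation
  enlarges the centralizer by \<open>q ^ 4\<close>. The power stays a separate factor so that the
  constant can leave the sum over eigenvalues.\<close>

lemma card_conj_class_two_equal:
  assumes "a \<noteq> b"
  shows "real (card (conj_class [b, a, a])) = m ^ 4 * q ^ 2 * (q ^ 2 + q + 1) * (1 / q ^ (4 * val (a - b)))"
proof -
  have "real (card (conj_class [b, a, a])) * (real (card (GL 1 :: 'a mat set)) *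
      real (card (GL 2 :: 'a mat set)) * real (card (annihilator (a - b))) ^ 4) = real (card (GL 3 :: 'a mat set))"
    using card_conj_class[of "[b, a, a]"] card_centralizer_two_equal[OF assms]
    by (simp add: numeral_3_eq_3 flip: of_nat_mult of_nat_power)
  also have "real (card (annihilator (a - b))) ^ 4 = q ^ (4 * val (a - b))"
    unfolding card_annihilator_diff[OF assms] by (simp add: power_mult[symmetric] mult.commute)
  also have "real (card (GL 3 :: 'a mat set))
      = m ^ 4 * q ^ 2 * (q ^ 2 + q + 1) * (real (card (GL 1 :: 'a mat set)) * real (card (GL 2 :: 'a mat set)))"
    unfolding real_card_GL_1 real_card_GL_2 real_card_GL_3 by (rule card_GL_quotients(1))
  finally have "real (card (conj_class [b, a, a])) * q ^ (4 * val (a - b)) *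
      (real (card (GL 1 :: 'a mat set)) * real (card (GL 2 :: 'a mat set)))
    = m ^ 4 * q ^ 2 * (q ^ 2 + q + 1) * (real (card (GL 1 :: 'a mat set)) * real (card (GL 2 :: 'a mat set)))"
    by (simp only: ac_simps)
  moreover have "real (card (GL 1 :: 'a mat set)) * real (card (GL 2 :: 'a mat set)) \<noteq> 0"
    unfolding real_card_GL_1 real_card_GL_2 using q_gt_1 m_pos by (simp add: power2_eq_1_iff)
  ultimately have "real (card (conj_class [b, a, a])) * q ^ (4 * val (a - b)) = m ^ 4 * q ^ 2 * (q ^ 2 + q + 1)"
    by (simp only: mult_cancel_right) blast
  then show ?thesis using q_gt_1 by (simp add: field_simps)
qed

text \<open>Each pair of eigenvalues governs the two entries at \<open>(i, j)\<close> and
  \<open>(j, i)\<close>, hence the 2 in the exponent.\<close>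

lemma card_conj_class_distinct:
  assumes "distinct [a, b, c]"
  shows "real (card (conj_class [a, b, c])) = m ^ 6 * q ^ 3 * (q + 1) * (q ^ 2 + q + 1) *
    (1 / q ^ (2 * (val (a - b) + val (a - c) + val (b - c))))"
proof -
  let ?v = "val (a - b) + val (a - c) + val (b - c)"
  have ne: "a \<noteq> b" "a \<noteq> c" "b \<noteq> c" using assms by auto
  let ?u = "card {x :: 'a. x dvd 1}"
  have "card (centralizer_GL (diag_of_list [a, b, c])) = ?u ^ 3 *
      (card (annihilator (a - b)) * card (annihilator (a - c)) * card (annihilator (b - c))) ^ 2"
    unfolding card_centralizer_distinct[OF assms refl] annihilator_minus[of b a] annihilator_minus[of c a]
      annihilator_minus[of c b]
    by (simp add: lessThan_Suc annihilator_minus[of b a] annihilator_minus[of c a]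
        annihilator_minus[of c b] power2_eq_square power3_eq_cube)
  also have "real \<dots> = ((q - 1) * m) ^ 3 * q ^ (2 * ?v)"
    unfolding of_nat_mult of_nat_power real_card_units card_annihilator_diff[OF ne(1)]
      card_annihilator_diff[OF ne(2)] card_annihilator_diff[OF ne(3)]
    by (simp add: power_add mult_2 power2_eq_square)
  finally have centralizer: "real (card (centralizer_GL (diag_of_list [a, b, c]))) = ((q - 1) * m) ^ 3 * q ^ (2 * ?v)" .
  have "card (conj_class [a, b, c]) * card (centralizer_GL (diag_of_list [a, b, c])) = card (GL 3 :: 'a mat set)"
    using card_conj_class[of "[a, b, c]"] by (simp add: numeral_3_eq_3)
  then have "real (card (conj_class [a, b, c])) * (((q - 1) * m) ^ 3 * q ^ (2 * ?v)) = real (card (GL 3 :: 'a mat set))"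
    unfolding centralizer[symmetric] of_nat_mult[symmetric] by simp
  also have "\<dots> = m ^ 6 * q ^ 3 * (q + 1) * (q ^ 2 + q + 1) * ((q - 1) * m) ^ 3"
    unfolding real_card_GL_3 by (rule card_GL_quotients(2))
  finally have "real (card (conj_class [a, b, c])) * q ^ (2 * ?v) * ((q - 1) * m) ^ 3
      = m ^ 6 * q ^ 3 * (q + 1) * (q ^ 2 + q + 1) * ((q - 1) * m) ^ 3"
    by (simp only: ac_simps)
  moreover have "((q - 1) * m) ^ 3 \<noteq> 0" using q_gt_1 m_pos by simp
  ultimately have "real (card (conj_class [a, b, c])) * q ^ (2 * ?v) = m ^ 6 * q ^ 3 * (q + 1) * (q ^ 2 + q + 1)"
    by (simp only: mult_cancel_right) blast
  then show ?thesis using q_gt_1 by (simp add: field_simps)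
qed

section \<open>Classes sorted by the multiplicity pattern of the eigenvalues\<close>

definition "scalar_lists = (\<lambda>a. [a, a, a]) ` (UNIV :: 'a set)"
text \<open>A repeated eigenvalue allows a canonical order, so each multiset is listed once here.
  Distinct eigenvalues have no such order in the ring; \<open>distinct_lists\<close> therefore keeps
  all 6 arrangements, and the count is divided by 6 later.\<close>

definition "two_equal_lists = (\<lambda>(a, b). [b, a, a]) ` {(a, b :: 'a). a \<noteq> b}"
definition "distinct_lists = {xs :: 'a list. length xs = 3 \<and> distinct xs}"

lemma distinct_lists_eq: "distinct_lists = (\<lambda>(a, b, c). [a, b, c]) ` {(a, b, c :: 'a). distinct [a, b, c]}"
proof (intro equalityI subsetI)
  fix xs :: "'a list" assume xs: "xs \<in> distinct_lists"
  then obtain a b c where "xs = [a, b, c]"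
    by (auto simp: distinct_lists_def numeral_3_eq_3 length_Suc_conv)
  with xs show "xs \<in> (\<lambda>(a, b, c). [a, b, c]) ` {(a, b, c). distinct [a, b, c]}"
    by (intro image_eqI[of _ _ "(a, b, c)"]) (simp_all add: distinct_lists_def)
qed (auto simp: distinct_lists_def)

lemma card_scalar_classes: "card (\<Union>xs\<in>scalar_lists. conj_class xs) = CARD('a)"
proof -
  have "(\<Sum>xs\<in>scalar_lists. card (conj_class xs)) = 1 * card (\<Union>xs\<in>scalar_lists. conj_class xs)"
  proof (rule card_Union_conj_class)
    fix xs assume "xs \<in> scalar_lists"
    then have "{ys \<in> scalar_lists. mset ys = mset xs} = {xs}"
      by (auto simp: scalar_lists_def dest!: mset_eq_setD)
    then show "card {ys \<in> scalar_lists. mset ys = mset xs} = 1" by simp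
  qed (simp add: scalar_lists_def)
  moreover have "(\<Sum>xs\<in>scalar_lists. card (conj_class xs)) = CARD('a)"
    unfolding scalar_lists_def by (subst sum.reindex) (auto simp: inj_on_def card_conj_class_scalar)
  ultimately show ?thesis by simp
qed

lemma card_two_equal_classes:
  "real (card (\<Union>xs\<in>two_equal_lists. conj_class xs))
    = q * m * (m ^ 4 * q ^ 2 * (q ^ 2 + q + 1)) * (\<Sum>x :: 'a | x \<noteq> 0. 1 / q ^ (4 * val x))"
proof -
  let ?K = "m ^ 4 * q ^ 2 * (q ^ 2 + q + 1)"
  have "(\<Sum>xs\<in>two_equal_lists. card (conj_class xs)) = 1 * card (\<Union>xs\<in>two_equal_lists. conj_class xs)"
  proof (rule card_Union_conj_class)
    fix xs assume "xs \<in> two_equal_lists"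
    then have "{ys \<in> two_equal_lists. mset ys = mset xs} = {xs}"
      unfolding two_equal_lists_def using mset_two_equal_eqD by fastforce
    then show "card {ys \<in> two_equal_lists. mset ys = mset xs} = 1" by simp
  qed (simp add: two_equal_lists_def)
  then have "real (card (\<Union>xs\<in>two_equal_lists. conj_class xs)) = (\<Sum>xs\<in>two_equal_lists. real (card (conj_class xs)))"
    by (metis mult_1 of_nat_sum)
  also have "\<dots> = (\<Sum>(a, b :: 'a) | a \<noteq> b. real (card (conj_class [b, a, a])))"
    unfolding two_equal_lists_def by (subst sum.reindex) (auto simp: inj_on_def case_prod_unfold)
  also have "\<dots> = (\<Sum>(a, b) | a \<noteq> b. ?K * (1 / q ^ (4 * val (a - b))))"
    by (rule sum.cong[OF refl]) (auto simp: card_conj_class_two_equal simp del: times_divide_eq_right)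
  \<comment> \<open>The summand depends only on \<open>x = a - b\<close>, so \<open>a\<close> runs
    freely over the ring.\<close>
  also have "\<dots> = (\<Sum>(a :: 'a, x)\<in>UNIV \<times> {x. x \<noteq> 0}. ?K * (1 / q ^ (4 * val x)))"
    by (rule sum.reindex_bij_witness[where i = "\<lambda>(a, x). (a, a - x)" and j = "\<lambda>(a, b). (a, a - b)"]) auto
  also have "\<dots> = (\<Sum>a\<in>(UNIV :: 'a set). \<Sum>x | x \<noteq> 0. ?K * (1 / q ^ (4 * val x)))"
    by (rule sum.cartesian_product[symmetric])
  also have "\<dots> = real CARD('a) * (?K * (\<Sum>x :: 'a | x \<noteq> 0. 1 / q ^ (4 * val x)))"
    by (simp only: sum_constant sum_distrib_left)
  finally show ?thesis unfolding real_card_ring by (simp only: mult.assoc)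
qed

lemma card_distinct_classes:
  "6 * real (card (\<Union>xs\<in>distinct_lists. conj_class xs))
    = q * m * (m ^ 6 * q ^ 3 * (q + 1) * (q ^ 2 + q + 1)) *
      (\<Sum>(x, y)\<in>nonzero_pairs. 1 / q ^ (2 * (val x + val y + val (x - y))))"
proof -
  let ?K = "m ^ 6 * q ^ 3 * (q + 1) * (q ^ 2 + q + 1)"
  have fin: "finite distinct_lists" unfolding distinct_lists_eq by (intro finite_imageI finite)
  have "(\<Sum>xs\<in>distinct_lists. card (conj_class xs)) = 6 * card (\<Union>xs\<in>distinct_lists. conj_class xs)"
  proof (rule card_Union_conj_class[OF fin])
    fix xs assume "xs \<in> distinct_lists"
    then have xs: "distinct xs" "length xs = 3" by (auto simp: distinct_lists_def)
    \<comment> \<open>For distinct lists, equality of multisets is equality of sets, so the lists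
      counted are the 3! orderings of \<open>set xs\<close>.\<close>
    have "{ys \<in> distinct_lists. mset ys = mset xs} = permutations_of_set (set xs)"
    proof (intro equalityI subsetI)
      fix ys assume "ys \<in> {ys \<in> distinct_lists. mset ys = mset xs}"
      then show "ys \<in> permutations_of_set (set xs)"
        using mset_eq_setD[of ys xs] by (simp add: distinct_lists_def permutations_of_set_def)
    next
      fix ys assume "ys \<in> permutations_of_set (set xs)"
      then have ys: "set ys = set xs" "distinct ys" by (simp_all add: permutations_of_set_def)
      then have "mset ys = mset xs" using set_eq_iff_mset_eq_distinct[OF ys(2) xs(1)] by simp
      then show "ys \<in> {ys \<in> distinct_lists. mset ys = mset xs}"
        using ys(2) xs(2) mset_eq_length[of ys xs] by (simp add: distinct_lists_def)
    qed
    then show "card {ys \<in> distinct_lists. mset ys = mset xs} = 6"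
      using xs by (simp add: distinct_card eval_nat_numeral)
  qed
  then have "6 * real (card (\<Union>xs\<in>distinct_lists. conj_class xs)) = (\<Sum>xs\<in>distinct_lists. real (card (conj_class xs)))"
    by (metis of_nat_mult of_nat_numeral of_nat_sum)
  also have "\<dots> = (\<Sum>(a, b, c :: 'a) | distinct [a, b, c]. real (card (conj_class [a, b, c])))"
    unfolding distinct_lists_eq by (subst sum.reindex) (auto simp: inj_on_def case_prod_unfold)
  also have "\<dots> = (\<Sum>(a, b, c) | distinct [a, b, c]. ?K * (1 / q ^ (2 * (val (a - b) + val (a - c) + val (b - c)))))"
    by (rule sum.cong[OF refl]) (auto simp: card_conj_class_distinct simp del: times_divide_eq_right)
  also have "\<dots> = (\<Sum>(a :: 'a, z)\<in>UNIV \<times> nonzero_pairs. (case z of (x, y) \<Rightarrow> ?K * (1 / q ^ (2 * (val x + val y + val (x - y))))))"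
    by (rule sum.reindex_bij_witness[where i = "\<lambda>(a, x, y). (a, a - x, a - y)" and j = "\<lambda>(a, b, c). (a, a - b, a - c)"])
      (auto simp: nonzero_pairs_def val_minus_commute)
  also have "\<dots> = (\<Sum>a\<in>(UNIV :: 'a set). \<Sum>(x, y)\<in>nonzero_pairs. ?K * (1 / q ^ (2 * (val x + val y + val (x - y)))))"
    by (rule sum.cartesian_product[symmetric])
  also have "\<dots> = real CARD('a) * (?K * (\<Sum>(x, y)\<in>nonzero_pairs. 1 / q ^ (2 * (val x + val y + val (x - y)))))"
    by (simp only: sum_constant sum_distrib_left case_prod_unfold)
  finally show ?thesis unfolding real_card_ring by (simp only: mult.assoc)
qed

end

section \<open>Closed forms of the valuation sums\<close>

lemma sum_powers:
  fixes q :: real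
  assumes "q > 1" "d > 0"
  shows "(\<Sum>a<n. q ^ (d * a)) = (q ^ (d * n) - 1) / (q ^ d - 1)"
proof -
  have "q ^ d \<noteq> 1" using one_less_power[OF assms] by simp
  then show ?thesis using geometric_sum[of "q ^ d" n] by (simp add: power_mult)
qed

context finite_chain_ring
begin

text \<open>With \<open>a = k - Suc i\<close> one has \<open>m = q ^ a * q ^ i\<close>, so
  \<open>m ^ 4\<close> absorbs the denominator and leaves \<open>q ^ (4 * a)\<close>. The size of
  the level contributes one more \<open>q ^ a\<close>, giving exponent 5.\<close>

lemma sum_val_4:
  "m ^ 4 * (\<Sum>x :: 'a | x \<noteq> 0. 1 / q ^ (4 * val x)) = (q - 1) * (\<Sum>a<k. q ^ (5 * a))"
proof -
  have "m ^ 4 * ((q - 1) * q ^ (k - Suc i) * (1 / q ^ (4 * i))) = (q - 1) * q ^ (5 * (k - Suc i))"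
    if "i < k" for i
  proof -
    define a where "a = k - Suc i"
    have "m = q ^ a * q ^ i" using that by (simp add: a_def flip: power_add)
    then have "m ^ 4 = q ^ (4 * a) * q ^ (4 * i)"
      by (simp add: power_mult_distrib mult.commute flip: power_mult)
    moreover have "q ^ (5 * a) = q ^ (4 * a) * q ^ a" by (simp flip: power_add)
    ultimately show ?thesis using q_gt_1 by (simp add: a_def)
  qed
  then have "m ^ 4 * (\<Sum>x :: 'a | x \<noteq> 0. 1 / q ^ (4 * val x)) = (\<Sum>i<k. (q - 1) * q ^ (5 * (k - Suc i)))"
    unfolding sum_val[where f = "\<lambda>i. 1 / q ^ (4 * i)"] sum_distrib_left by (intro sum.cong refl) simp
  then show ?thesis
    by (simp only: sum_distrib_left[symmetric] sum.nat_diff_reindex[of "\<lambda>a. q ^ (5 * a)"])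
qed

text \<open>Four factors \<open>m\<close> are split at \<open>i\<close> and two at \<open>j\<close>,
  to match the denominator for the valuations \<open>i, i, j\<close>.\<close>

lemma m_power_6:
  assumes "i < k" "j < k"
  shows "m ^ 6 = q ^ (4 * (k - Suc i)) * q ^ (2 * (k - Suc j)) * q ^ (4 * i + 2 * j)"
proof -
  have m: "m = q ^ (k - Suc i) * q ^ i" "m = q ^ (k - Suc j) * q ^ j"
    using assms by (simp_all flip: power_add)
  have "m ^ 4 = q ^ (4 * (k - Suc i)) * q ^ (4 * i)"
    by (subst m(1)) (simp only: power_mult_distrib power_mult[symmetric] mult.commute[of 4])
  moreover have "m ^ 2 = q ^ (2 * (k - Suc j)) * q ^ (2 * j)"
    by (subst m(2)) (simp only: power_mult_distrib power_mult[symmetric] mult.commute[of 2])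
  moreover have "m ^ 6 = m ^ 4 * m ^ 2" by (simp flip: power_add)
  ultimately show ?thesis by (simp only: power_add ac_simps)
qed

text \<open>As in \<open>sum_val_4\<close>, the power of \<open>m\<close> clears the denominators.
  The exponents are 8 = 6 + 2 for equal valuations and 5 = 4 + 1, 3 = 2 + 1 for mixed ones; the
  second summands come from the level sizes.\<close>

lemma sum_nonzero_pairs_6:
  "m ^ 6 * (\<Sum>(x, y)\<in>nonzero_pairs. 1 / q ^ (2 * (val x + val y + val (x - y))))
    = (q - 1) * (q - 2) * (\<Sum>a<k. q ^ (8 * a))
      + 3 * (q - 1) ^ 2 * (\<Sum>a<k. \<Sum>b<a. q ^ (5 * a) * q ^ (3 * b))"
proof -
  let ?F = "\<lambda>i j l. 1 / q ^ (2 * (i + j + l))"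
  have diag: "m ^ 6 * ((q - 1) * (q - 2) * q ^ (2 * (k - Suc i)) * ?F i i i) = (q - 1) * (q - 2) * q ^ (8 * (k - Suc i))"
    if "i < k" for i
  proof -
    define a where "a = k - Suc i"
    have "m ^ 6 = q ^ (6 * a) * q ^ (2 * (i + i + i))"
      unfolding m_power_6[OF that that] a_def[symmetric] power_add[symmetric] by (rule arg_cong[of _ _ "power q"]) simp
    moreover have "q ^ (8 * a) = q ^ (6 * a) * q ^ (2 * a)" by (simp flip: power_add)
    ultimately show ?thesis using q_gt_1 unfolding a_def[symmetric] by simp
  qed
  have off_diag: "m ^ 6 * ((q - 1) ^ 2 * q ^ (k - Suc i) * q ^ (k - Suc j) * ?F i i j)
      = (q - 1) ^ 2 * (q ^ (5 * (k - Suc i)) * q ^ (3 * (k - Suc j)))"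
    if "i < k" "j < k" for i j
  proof -
    define a b where "a = k - Suc i" and "b = k - Suc j"
    have "m ^ 6 = q ^ (4 * a) * q ^ (2 * b) * q ^ (2 * (i + i + j))"
      unfolding m_power_6[OF that] a_def[symmetric] b_def[symmetric] by simp
    moreover have "q ^ (5 * a) = q ^ (4 * a) * q ^ a" "q ^ (3 * b) = q ^ (2 * b) * q ^ b"
      by (simp_all flip: power_add)
    ultimately show ?thesis using q_gt_1 unfolding a_def[symmetric] b_def[symmetric] by simp
  qed
  have "m ^ 6 * (\<Sum>(x, y)\<in>nonzero_pairs. 1 / q ^ (2 * (val x + val y + val (x - y))))
      = (\<Sum>i<k. m ^ 6 * ((q - 1) * (q - 2) * q ^ (2 * (k - Suc i)) * ?F i i i))
        + 3 * (\<Sum>i<k. \<Sum>j\<in>{i<..<k}. m ^ 6 * ((q - 1) ^ 2 * q ^ (k - Suc i) * q ^ (k - Suc j) * ?F i i j))"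
    by (subst sum_nonzero_pairs[where F = ?F])
      (simp_all only: ac_simps distrib_left mult.left_commute[of _ 3] sum_distrib_left)
  also have "(\<Sum>i<k. m ^ 6 * ((q - 1) * (q - 2) * q ^ (2 * (k - Suc i)) * ?F i i i))
      = (\<Sum>i<k. (q - 1) * (q - 2) * q ^ (8 * (k - Suc i)))"
    using diag by (intro sum.cong refl) blast
  also have "\<dots> = (q - 1) * (q - 2) * (\<Sum>a<k. q ^ (8 * a))"
    using sum.nat_diff_reindex[of "\<lambda>a. q ^ (8 * a)" k] by (simp add: sum_distrib_left[symmetric])
  also have "(\<Sum>i<k. \<Sum>j\<in>{i<..<k}. m ^ 6 * ((q - 1) ^ 2 * q ^ (k - Suc i) * q ^ (k - Suc j) * ?F i i j))
      = (\<Sum>i<k. \<Sum>j\<in>{i<..<k}. (q - 1) ^ 2 * (q ^ (5 * (k - Suc i)) * q ^ (3 * (k - Suc j))))"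
    using off_diag by (intro sum.cong refl) simp
  \<comment> \<open>Substituting \<open>b = k - Suc j\<close> reverses the order, so
    \<open>i < j < k\<close> becomes \<open>b < k - Suc i\<close>.\<close>
  also have "\<dots> = (\<Sum>i<k. \<Sum>b<k - Suc i. (q - 1) ^ 2 * (q ^ (5 * (k - Suc i)) * q ^ (3 * b)))"
    by (intro sum.cong refl sum.reindex_bij_witness[where i = "\<lambda>b. k - Suc b" and j = "\<lambda>j. k - Suc j"]) auto
  also have "\<dots> = (\<Sum>a<k. \<Sum>b<a. (q - 1) ^ 2 * (q ^ (5 * a) * q ^ (3 * b)))"
    by (rule sum.nat_diff_reindex)
  also have "\<dots> = (q - 1) ^ 2 * (\<Sum>a<k. \<Sum>b<a. q ^ (5 * a) * q ^ (3 * b))"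
    by (simp only: sum_distrib_left)
  finally show ?thesis by (simp only: mult.assoc)
qed

text \<open>The inner sum is geometric with ratio \<open>q ^ 3\<close>. The multiplier
  \<open>q ^ 3 - 1\<close> is available later, as \<open>q ^ 2 + q + 1\<close> from the class size
  times one factor \<open>q - 1\<close> of the pair count.\<close>

lemma sum_mixed_powers:
  "(q ^ 3 - 1) * (\<Sum>a<n. \<Sum>b<a. q ^ (5 * a) * q ^ (3 * b)) = (\<Sum>a<n. q ^ (8 * a)) - (\<Sum>a<n. q ^ (5 * a))"
proof -
  have "(q ^ 3 - 1) * (\<Sum>b<a. q ^ (5 * a) * q ^ (3 * b)) = q ^ (8 * a) - q ^ (5 * a)" for a
  proof -
    have "q ^ 3 \<noteq> 1" using one_less_power[OF q_gt_1, of 3] by simp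
    then have "(q ^ 3 - 1) * (\<Sum>b<a. q ^ (3 * b)) = q ^ (3 * a) - 1"
      using sum_powers[OF q_gt_1, of 3 a] by simp
    moreover have "(q ^ 3 - 1) * (\<Sum>b<a. q ^ (5 * a) * q ^ (3 * b)) = q ^ (5 * a) * ((q ^ 3 - 1) * (\<Sum>b<a. q ^ (3 * b)))"
      by (simp only: sum_distrib_left ac_simps)
    ultimately show ?thesis by (simp add: right_diff_distrib flip: power_add)
  qed
  then show ?thesis by (simp add: sum_distrib_left sum_subtractf)
qed

section \<open>Assembling the three families\<close>

lemma Diag_3_eq:
  "(Diag 3 :: 'a mat set) = (\<Union>xs\<in>scalar_lists. conj_class xs)
    \<union> (\<Union>xs\<in>two_equal_lists. conj_class xs) \<union> (\<Union>xs\<in>distinct_lists. conj_class xs)"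
proof (intro equalityI subsetI)
  fix A :: "'a mat" assume "A \<in> Diag 3"
  then obtain xs where "A \<in> conj_class xs" "length xs = 3" unfolding Diag_eq by blast
  then obtain a b c where abc: "A \<in> conj_class [a, b, c]"
    by (auto simp: numeral_3_eq_3 length_Suc_conv)
  consider "a = b" "b = c" | "a = b" "b \<noteq> c" | "a = c" "b \<noteq> c" | "b = c" "a \<noteq> b" | "distinct [a, b, c]"
    by auto
  then obtain xs where "mset xs = mset [a, b, c]" "xs \<in> scalar_lists \<union> two_equal_lists \<union> distinct_lists"
  proof cases
    case 1
    then show ?thesis using that[of "[a, a, a]"] by (simp add: scalar_lists_def)
  next
    case 2
    then show ?thesis using that[of "[c, a, a]"] by (simp add: two_equal_lists_def image_iff)
  next
    case 3
    then show ?thesis using that[of "[b, a, a]"] by (simp add: two_equal_lists_def image_iff)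
  next
    case 4
    then show ?thesis using that[of "[a, b, b]"] by (simp add: two_equal_lists_def image_iff)
  next
    case 5
    then show ?thesis using that[of "[a, b, c]"] by (simp add: distinct_lists_def)
  qed
  then show "A \<in> (\<Union>xs\<in>scalar_lists. conj_class xs)
    \<union> (\<Union>xs\<in>two_equal_lists. conj_class xs) \<union> (\<Union>xs\<in>distinct_lists. conj_class xs)"
    using abc conj_class_cong by blast
next
  fix A :: "'a mat"
  assume "A \<in> (\<Union>xs\<in>scalar_lists. conj_class xs)
    \<union> (\<Union>xs\<in>two_equal_lists. conj_class xs) \<union> (\<Union>xs\<in>distinct_lists. conj_class xs)"
  then obtain xs where xs: "A \<in> conj_class xs" "xs \<in> scalar_lists \<union> two_equal_lists \<union> distinct_lists" by blast
  have "length xs = 3"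
    using xs(2) by (auto simp: scalar_lists_def two_equal_lists_def distinct_lists_def)
  then show "A \<in> Diag 3" unfolding Diag_eq using xs(1) by blast
qed

lemma conj_classes_disjoint:
  assumes "\<And>xs ys. xs \<in> S \<Longrightarrow> ys \<in> T \<Longrightarrow> mset xs \<noteq> mset ys"
  shows "(\<Union>xs\<in>S. conj_class xs) \<inter> (\<Union>xs\<in>T. conj_class (xs :: 'a list)) = {}"
  using assms mem_conj_class_imp_mset_eq by blast

lemma card_Diag_3:
  "real (card (Diag 3 :: 'a mat set)) = q ^ k
    + q ^ (k + 2) * (q ^ 3 - 1) * (q ^ (5 * k) - 1) / (q ^ 5 - 1)
    + q ^ (k + 3) * (q ^ 3 - 1) * (q - 2) * (q + 1) * (q ^ (8 * k) - 1) / (6 * (q ^ 8 - 1))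
    + q ^ (k + 3) * (q ^ 2 - 1) / 2
        * ((q ^ (8 * k) - q ^ 8) / (q ^ 8 - 1) - (q ^ (5 * k) - q ^ 5) / (q ^ 5 - 1))"
proof -
  let ?U1 = "\<Union>xs\<in>scalar_lists. conj_class xs"
  let ?U2 = "\<Union>xs\<in>two_equal_lists. conj_class xs"
  let ?U3 = "\<Union>xs\<in>distinct_lists. conj_class xs"
  have "finite (Diag 3 :: 'a mat set)"
    by (rule finite_subset[OF _ finite_carrier_mat[of 3 3]]) (auto simp: Diag_def)
  then have fin: "finite ?U1" "finite ?U2" "finite ?U3"
    unfolding Diag_3_eq by (simp_all only: finite_Un)
  have "?U1 \<inter> ?U2 = {}"
    by (rule conj_classes_disjoint) (auto simp: scalar_lists_def two_equal_lists_def dest!: mset_eq_setD)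
  moreover have "?U1 \<inter> ?U3 = {}"
    by (rule conj_classes_disjoint)
      (auto simp: scalar_lists_def distinct_lists_def dest!: mset_eq_imp_distinct_iff)
  moreover have "?U2 \<inter> ?U3 = {}"
    by (rule conj_classes_disjoint)
      (auto simp: two_equal_lists_def distinct_lists_def dest!: mset_eq_imp_distinct_iff)
  ultimately have "card (Diag 3 :: 'a mat set) = card ?U1 + card ?U2 + card ?U3"
    unfolding Diag_3_eq using fin by (subst card_Un_disjoint, auto)+
  then have total: "real (card (Diag 3 :: 'a mat set)) = real (card ?U1) + real (card ?U2) + real (card ?U3)"
    by simp
  define A5 where "A5 = (\<Sum>a<k. q ^ (5 * a))"
  define A8 where "A8 = (\<Sum>a<k. q ^ (8 * a))"
  define S where "S = (\<Sum>a<k. \<Sum>b<a. q ^ (5 * a) * q ^ (3 * b))"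
  have S: "(q ^ 3 - 1) * S = A8 - A5" unfolding S_def A5_def A8_def by (rule sum_mixed_powers)
  have U1: "real (card ?U1) = q ^ k" unfolding card_scalar_classes real_card_ring q_power_k ..
  have U2: "real (card ?U2) = q ^ (k + 2) * (q ^ 3 - 1) * A5"
  proof -
    have "real (card ?U2) = q * m * (q ^ 2 * (q ^ 2 + q + 1)) * (m ^ 4 * (\<Sum>x :: 'a | x \<noteq> 0. 1 / q ^ (4 * val x)))"
      unfolding card_two_equal_classes by (simp only: ac_simps)
    also have "\<dots> = q ^ k * q ^ 2 * ((q ^ 2 + q + 1) * (q - 1)) * A5"
      unfolding sum_val_4 q_power_k A5_def by (simp only: ac_simps)
    also have "(q ^ 2 + q + 1) * (q - 1) = q ^ 3 - 1"
      by (simp add: algebra_simps power2_eq_square power3_eq_cube)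
    finally show ?thesis by (simp only: power_add)
  qed
  have U3: "6 * real (card ?U3)
      = q ^ (k + 3) * (q ^ 3 - 1) * (q - 2) * (q + 1) * A8 + 3 * (q ^ (k + 3) * (q ^ 2 - 1) * (A8 - A5))"
  proof -
    have "6 * real (card ?U3) = q * m * (q ^ 3 * (q + 1) * (q ^ 2 + q + 1)) *
        (m ^ 6 * (\<Sum>(x, y)\<in>nonzero_pairs. 1 / q ^ (2 * (val x + val y + val (x - y)))))"
      unfolding card_distinct_classes by (simp only: ac_simps)
    also have "\<dots> = q ^ k * (q ^ 3 * (q + 1) * (q ^ 2 + q + 1)) * ((q - 1) * (q - 2) * A8 + 3 * (q - 1) ^ 2 * S)"
      unfolding sum_nonzero_pairs_6 q_power_k A8_def S_def ..
    also have "\<dots> = q ^ k * q ^ 3 * ((q ^ 2 + q + 1) * (q - 1)) * (q - 2) * (q + 1) * A8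
        + 3 * (q ^ k * q ^ 3 * ((q - 1) * (q + 1)) * (((q ^ 2 + q + 1) * (q - 1)) * S))"
    proof -
      \<comment> \<open>Of the two factors \<open>d = q - 1\<close> in front of \<open>S\<close>,
        one joins \<open>e\<close> to form \<open>q ^ 3 - 1\<close> and the other joins
        \<open>r\<close> to form \<open>q ^ 2 - 1\<close>. Stating this for variables keeps the
        large powers opaque.\<close>
      have "K * (c * r * e) * (d * t * A + 3 * d ^ 2 * S)
          = K * c * (e * d) * t * r * A + 3 * (K * c * (d * r) * ((e * d) * S))" for K c r e d t A S :: real
        by (simp add: algebra_simps power2_eq_square)
      then show ?thesis .
    qed
    also have "(q ^ 2 + q + 1) * (q - 1) = q ^ 3 - 1"
      by (simp add: algebra_simps power2_eq_square power3_eq_cube)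
    also have "(q - 1) * (q + 1) = q ^ 2 - 1"
      by (simp add: algebra_simps power2_eq_square)
    finally show ?thesis unfolding S by (simp only: power_add)
  qed
  have ne: "q ^ 5 - 1 \<noteq> 0" "q ^ 8 - 1 \<noteq> 0"
    using one_less_power[OF q_gt_1, of 5] one_less_power[OF q_gt_1, of 8] by simp_all
  have A5: "A5 = (q ^ (5 * k) - 1) / (q ^ 5 - 1)" and A8: "A8 = (q ^ (8 * k) - 1) / (q ^ 8 - 1)"
    unfolding A5_def A8_def by (simp_all only: sum_powers[OF q_gt_1] zero_less_numeral)
  \<comment> \<open>The fractions in the formula are the geometric sums without their term at 0; the
    two missing 1s cancel in the difference \<open>A8 - A5\<close>.\<close>
  have A5': "(q ^ (5 * k) - q ^ 5) / (q ^ 5 - 1) = A5 - 1" and A8': "(q ^ (8 * k) - q ^ 8) / (q ^ 8 - 1) = A8 - 1"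
    unfolding A5 A8 using ne by (simp_all add: field_simps)
  have "real (card (Diag 3 :: 'a mat set)) = q ^ k + q ^ (k + 2) * (q ^ 3 - 1) * A5
      + q ^ (k + 3) * (q ^ 3 - 1) * (q - 2) * (q + 1) * A8 / 6
      + q ^ (k + 3) * (q ^ 2 - 1) / 2 * ((A8 - 1) - (A5 - 1))"
    unfolding total U1 U2 using U3 by (simp add: field_simps)
  also have "q ^ (k + 2) * (q ^ 3 - 1) * A5 = q ^ (k + 2) * (q ^ 3 - 1) * (q ^ (5 * k) - 1) / (q ^ 5 - 1)"
    unfolding A5 by simp
  also have "q ^ (k + 3) * (q ^ 3 - 1) * (q - 2) * (q + 1) * A8 / 6
      = q ^ (k + 3) * (q ^ 3 - 1) * (q - 2) * (q + 1) * (q ^ (8 * k) - 1) / (6 * (q ^ 8 - 1))"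
    unfolding A8 by simp
  finally show ?thesis unfolding A5' A8' .
qed

end

section \<open>The ring of integers modulo a prime power\<close>

lemma of_int_to_int_mod_ring: "of_int (to_int_mod_ring x) = (x :: 'a :: nontriv mod_ring)"
  by (simp add: of_int_of_int_mod_ring)

text \<open>For \<open>i \<le> k\<close> the power \<open>p ^ i\<close> divides the modulus, so
  divisibility by it survives reduction and can be tested on the integer representative.\<close>

lemma of_nat_power_dvd_mod_ring_iff:
  assumes "CARD('a :: nontriv) = p ^ k" "i \<le> k"
  shows "(of_nat p :: 'a mod_ring) ^ i dvd x \<longleftrightarrow> int p ^ i dvd to_int_mod_ring x"
proof
  have card_dvd: "int p ^ i dvd int CARD('a)"
    using assms by (simp add: le_imp_power_dvd)
  assume "(of_nat p :: 'a mod_ring) ^ i dvd x"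
  then obtain y where "x = of_nat p ^ i * y" by (elim dvdE)
  also have "\<dots> = of_int (int p ^ i * to_int_mod_ring y)"
    by (simp add: of_int_to_int_mod_ring)
  finally have "x = of_int_mod_ring (int p ^ i * to_int_mod_ring y)"
    by (simp only: of_int_of_int_mod_ring)
  then have "to_int_mod_ring x = (int p ^ i * to_int_mod_ring y) mod int CARD('a)"
    by (simp only:) (transfer, simp)
  then show "int p ^ i dvd to_int_mod_ring x"
    using card_dvd by (simp add: dvd_mod)
next
  assume "int p ^ i dvd to_int_mod_ring x"
  then obtain z where "to_int_mod_ring x = int p ^ i * z" by (elim dvdE)
  then have "x = of_int (int p ^ i * z)"
    by (metis of_int_to_int_mod_ring)
  then show "(of_nat p :: 'a mod_ring) ^ i dvd x" by simp
qed

text \<open>The representatives in question are \<open>p ^ i * j\<close> with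
  \<open>j < p ^ (k - i)\<close>; all of them lie below the modulus, so reduction leaves them
  unchanged.\<close>

lemma card_of_nat_power_multiples_mod_ring:
  assumes "CARD('a :: nontriv) = p ^ k" "i \<le> k" "p > 0"
  shows "card {x :: 'a mod_ring. of_nat p ^ i dvd x} = p ^ (k - i)"
proof -
  have split: "p ^ k = p ^ i * p ^ (k - i)" using assms(2) by (simp flip: power_add)
  have "bij_betw (\<lambda>j. of_int_mod_ring (int p ^ i * int j)) {..<p ^ (k - i)} {x :: 'a mod_ring. of_nat p ^ i dvd x}"
  proof (rule bij_betw_byWitness[where f' = "\<lambda>x. nat (to_int_mod_ring x div int p ^ i)"])
    have lt: "int p ^ i * int j < int CARD('a)" if "j < p ^ (k - i)" for j
    proof -
      have "p ^ i * j < p ^ k" unfolding split using that assms(3) by simp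
      then show ?thesis unfolding assms(1) by (metis of_nat_less_iff of_nat_mult of_nat_power)
    qed
    show "\<forall>j\<in>{..<p ^ (k - i)}.
        nat (to_int_mod_ring (of_int_mod_ring (int p ^ i * int j) :: 'a mod_ring) div int p ^ i) = j"
      using lt assms(3) by (simp add: to_int_mod_ring_of_int_mod_ring)
    show "\<forall>x\<in>{x :: 'a mod_ring. of_nat p ^ i dvd x}.
        of_int_mod_ring (int p ^ i * int (nat (to_int_mod_ring x div int p ^ i))) = x"
    proof
      fix x :: "'a mod_ring" assume "x \<in> {x. of_nat p ^ i dvd x}"
      then have "int p ^ i dvd to_int_mod_ring x" using of_nat_power_dvd_mod_ring_iff[OF assms(1,2)] by simp
      moreover have "to_int_mod_ring x \<ge> 0" using range_to_int_mod_ring[where ?'a = 'a] by auto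
      ultimately show "of_int_mod_ring (int p ^ i * int (nat (to_int_mod_ring x div int p ^ i))) = x"
        using assms(3) by (simp add: pos_imp_zdiv_nonneg_iff)
    qed
    show "(\<lambda>j. of_int_mod_ring (int p ^ i * int j)) ` {..<p ^ (k - i)} \<subseteq> {x :: 'a mod_ring. of_nat p ^ i dvd x}"
      using lt by (auto simp: of_nat_power_dvd_mod_ring_iff[OF assms(1,2)] to_int_mod_ring_of_int_mod_ring)
    show "(\<lambda>x. nat (to_int_mod_ring x div int p ^ i)) ` {x :: 'a mod_ring. of_nat p ^ i dvd x} \<subseteq> {..<p ^ (k - i)}"
    proof
      fix j assume "j \<in> (\<lambda>x. nat (to_int_mod_ring x div int p ^ i)) ` {x :: 'a mod_ring. of_nat p ^ i dvd x}"
      then obtain x :: "'a mod_ring" where j: "j = nat (to_int_mod_ring x div int p ^ i)" by blast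
      have "to_int_mod_ring x \<in> {0..<int CARD('a)}" using range_to_int_mod_ring[where ?'a = 'a] by blast
      then have "0 \<le> to_int_mod_ring x" "to_int_mod_ring x < int p ^ (k - i) * int p ^ i"
        unfolding assms(1) split by (simp_all add: mult.commute)
      moreover have pos: "int p ^ i > 0" using assms(3) by simp
      moreover have "to_int_mod_ring x div int p ^ i * int p ^ i \<le> to_int_mod_ring x"
        using div_mult_mod_eq[of "to_int_mod_ring x" "int p ^ i"] pos_mod_sign[OF pos, of "to_int_mod_ring x"]
        by linarith
      ultimately have "to_int_mod_ring x div int p ^ i < int p ^ (k - i)"
        using mult_less_cancel_right_pos[OF pos] by fastforce
      then show "j \<in> {..<p ^ (k - i)}" 
        using pos_imp_zdiv_nonneg_iff[OF pos] \<open>0 \<le> to_int_mod_ring x\<close> unfolding j by (simp add: nat_less_iff)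
    qed
  qed
  then show ?thesis by (simp add: bij_betw_same_card[symmetric])
qed

lemma finite_chain_ring_mod_ring:
  assumes "prime p" "k > 0" "CARD('a :: nontriv) = p ^ k"
  shows "finite_chain_ring (of_nat p :: 'a mod_ring) p k"
proof
  fix x :: "'a mod_ring"
  have p_dvd: "of_nat p dvd x \<longleftrightarrow> int p dvd to_int_mod_ring x"
    using of_nat_power_dvd_mod_ring_iff[OF assms(3), of 1 x] assms(2) by simp
  show "x dvd 1 \<longleftrightarrow> \<not> of_nat p dvd x"
  proof
    assume "x dvd 1"
    show "\<not> of_nat p dvd x"
    proof
      assume "of_nat p dvd x"
      then have "of_nat p dvd (1 :: 'a mod_ring)" using \<open>x dvd 1\<close> by (rule dvd_trans)
      then have "int p ^ 1 dvd to_int_mod_ring (1 :: 'a mod_ring)"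
        using of_nat_power_dvd_mod_ring_iff[OF assms(3), of 1 "1"] assms(2) by simp
      moreover have "to_int_mod_ring (1 :: 'a mod_ring) = 1" by transfer simp
      ultimately show False using prime_gt_1_nat[OF assms(1)] by (simp add: zdvd1_eq)
    qed
  next
    assume "\<not> of_nat p dvd x"
    then have "\<not> int p dvd to_int_mod_ring x" using p_dvd by simp
    then have "coprime (int p) (to_int_mod_ring x)"
      using assms(1) by (intro prime_imp_coprime) auto
    then have "coprime (to_int_mod_ring x) (int p ^ k)" by (simp add: coprime_commute)
    \<comment> \<open>In the Bezout identity the term with \<open>p ^ k\<close> vanishes in the
      ring, and \<open>u\<close> becomes the inverse of \<open>x\<close>.\<close>
    then obtain u v where "u * to_int_mod_ring x + v * int p ^ k = 1"
      by (metis bezout_int coprime_iff_gcd_eq_1)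
    then have "(of_int (u * to_int_mod_ring x + v * int p ^ k) :: 'a mod_ring) = of_int 1" by simp
    moreover have "(of_int (int p ^ k) :: 'a mod_ring) = 0"
      using of_nat_card_eq_0[where ?'a = 'a] assms(3) by simp
    ultimately have "of_int u * x = 1"
      unfolding of_int_add of_int_mult of_int_to_int_mod_ring by simp
    then show "x dvd 1" by (metis dvd_triv_right)
  qed
next
  show "p > 1" using assms(1) by (rule prime_gt_1_nat)
  show "k > 0" by (rule assms(2))
  show "card {x :: 'a mod_ring. of_nat p ^ i dvd x} = p ^ (k - i)" if "i \<le> k" for i
    using card_of_nat_power_multiples_mod_ring[OF assms(3) that] assms(1) prime_gt_0_nat by blast
qed

theorem theorem6p1:
  fixes p k :: nat
  assumes "prime p" and "k > 0"
    and "CARD('a :: nontriv) = p ^ k"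
  shows "real (card (Diag 3 :: 'a mod_ring mat set)) =
      real p ^ k
    + real p ^ (k + 2) * (real p ^ 3 - 1) * (real p ^ (5 * k) - 1) / (real p ^ 5 - 1)
    + real p ^ (k + 3) * (real p ^ 3 - 1) * (real p - 2) * (real p + 1) * (real p ^ (8 * k) - 1)
        / (6 * (real p ^ 8 - 1))
    + real p ^ (k + 3) * (real p ^ 2 - 1) / 2
        * ((real p ^ (8 * k) - real p ^ 8) / (real p ^ 8 - 1)
            - (real p ^ (5 * k) - real p ^ 5) / (real p ^ 5 - 1))"
  by (rule finite_chain_ring.card_Diag_3[OF finite_chain_ring_mod_ring[OF assms]])

end
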